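(* Let $C$ be a convex body in $\mathbb{R}^d$, $d\geq 2$, let $F\in\{D,w,I\}$ (diameter, minimal width, inradius), and let $n\geq 2$. Except possibly when $d=2$ and $F=D$, there exists an $n$-division $P$ of $C$ (given by $n-1$ successive hyperplane cuts) with $\widetilde F(P)=\widetilde F_n(C)$, i.e. an $n$-division maximizing the smallest value of $F$ on the subsets; moreover, such an optimal $n$-division can be chosen to be balanced. Furthermore: (1) If $F=D$ (in any dimension $d\geq2$), then any optimal $n$-division of $C$ is balanced, and $\widetilde D_n(C)=D(C)$. (2) If $F=w$, then $$\frac{w(C)}{n}\leq\widetilde w_n(C)\leq\min\left\{w(C),\frac{D(C)}{2}\right\},$$ and both bounds are sharp (for each of the two inequalities there are $C$ and $n$ for which equality holds). (3) If $F=I$, then $\widetilde I_n(C)\geq I(C)/n$.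
   Context: A convex body in $\mathbb{R}^d$ is a compact convex set with non-empty interior. An $n$-division $P$ of $C$ is a decomposition of $C$ into $n$ closed subsets $C_1,\ldots,C_n$ with non-empty interior, obtained by $n-1$ successive hyperplane cuts: starting from $C$ itself, at each step exactly one of the current subsets is divided into two subsets by a hyperplane (the other current subsets are not cut). All the subsets are convex. For a compact set: the diameter $D$ is the largest distance between two of its points; the (minimal) width $w$ is the smallest distance between two parallel supporting hyperplanes of the set; the inradius $I$ is the largest radius of a ball contained in the set. For $F\in\{D,w,I\}$ and an $n$-division $P$ of $C$ with subsets $C_1,\ldots,C_n$, put $\widetilde F(P)=\min\{F(C_1),\ldots,F(C_n)\}$ and $$\widetilde F_n(C)=\sup\{\widetilde F(P): P\text{ is an }n\text{-division of }C\}$$ (so $\widetilde D_n(C)$, $\widetilde w_n(C)$, $\widetilde I_n(C)$ denote the respective values). An $n$-division $P$ is optimal (for the Max-min problem for $F$) if $\widetilde F(P)=\widetilde F_n(C)$. It is balanced (for $F$) if $F(C_1)=\ldots=F(C_n)$. *)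

theory Defs
  imports "HOL-Analysis.Analysis"
begin

definition convex_body :: "'a::euclidean_space set \<Rightarrow> bool" where
  "convex_body C \<longleftrightarrow> compact C \<and> convex C \<and> interior C \<noteq> {}"

text \<open>The hyperplanes are the two boundary hyperplanes of a slab containing the set, so
  they support it from opposite sides (a single hyperplane is not counted twice unless the
  set lies in it).\<close>

definition parallel_supporting_hyperplanes ::
    "'a::euclidean_space set \<Rightarrow> 'a set \<Rightarrow> 'a set \<Rightarrow> bool" where
  "parallel_supporting_hyperplanes S H1 H2 \<longleftrightarrow>
     (\<exists>a b c. a \<noteq> 0 \<and> H1 = {x. a \<bullet> x = b} \<and> H2 = {x. a \<bullet> x = c} \<and>
        S \<subseteq> {x. b \<le> a \<bullet> x \<and> a \<bullet> x \<le> c} \<and> H1 \<inter> S \<noteq> {} \<and> H2 \<inter> S \<noteq> {})"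

definition min_width :: "'a::euclidean_space set \<Rightarrow> real" where
  "min_width S = Inf {setdist H1 H2 | H1 H2. parallel_supporting_hyperplanes S H1 H2}"

text \<open>The condition on the sign of the radius is needed because \<open>cball x r\<close> is empty for
  negative \<open>r\<close>.\<close>

definition inradius :: "'a::euclidean_space set \<Rightarrow> real" where
  "inradius S = Sup {r. 0 \<le> r \<and> (\<exists>x. cball x r \<subseteq> S)}"

text \<open>Each cut is required to produce two pieces with non-empty interior. This is the same as
  requiring it of the final pieces only, since every intermediate piece contains a final one.
  It also makes the pieces pairwise distinct, so that a division into \<open>n\<close> pieces is a set of
  exactly \<open>n\<close> sets.\<close>

inductive is_division :: "'a::euclidean_space set \<Rightarrow> nat \<Rightarrow> 'a set set \<Rightarrow> bool"
  for C where
  whole: "is_division C 1 {C}"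
| cut: "is_division C (Suc n)
          (insert (K \<inter> {x. a \<bullet> x \<le> b}) (insert (K \<inter> {x. a \<bullet> x \<ge> b}) (P - {K})))"
  if "is_division C n P" "K \<in> P" "a \<noteq> 0"
     "interior (K \<inter> {x. a \<bullet> x \<le> b}) \<noteq> {}" "interior (K \<inter> {x. a \<bullet> x \<ge> b}) \<noteq> {}"

definition min_value :: "('a set \<Rightarrow> real) \<Rightarrow> 'a set set \<Rightarrow> real" where
  "min_value F P = Min (F ` P)"

definition maxmin_value ::
    "('a::euclidean_space set \<Rightarrow> real) \<Rightarrow> nat \<Rightarrow> 'a set \<Rightarrow> real" where
  "maxmin_value F n C = Sup {min_value F P | P. is_division C n P}"

definition optimal_division ::
    "('a::euclidean_space set \<Rightarrow> real) \<Rightarrow> nat \<Rightarrow> 'a set \<Rightarrow> 'a set set \<Rightarrow> bool" where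
  "optimal_division F n C P \<longleftrightarrow> is_division C n P \<and> min_value F P = maxmin_value F n C"

definition balanced :: "('a set \<Rightarrow> real) \<Rightarrow> 'a set set \<Rightarrow> bool" where
  "balanced F P \<longleftrightarrow> (\<forall>K\<in>P. \<forall>L\<in>P. F K = F L)"

end

theory Submission imports Defs begin

text \<open>For the width and the inradius the proof works with divisions as binary trees of cuts
  (\<open>splits_iff_is_division\<close>) and with an arbitrary functional that is monotone, positive,
  homogeneous, upper semicontinuous and bounded by the extent of the body in every direction (the
  locale \<open>size_functional\<close>).

  Optimal divisions exist by compactness. Along a maximising sequence of divisions the hyperplanes
  subconverge, and the limit pieces contain the limits of the pieces, so upper semicontinuity
  gives them at least the limit value; this value is positive, so no limit piece degenerates
  (\<open>fits_limit\<close>). Positivity comes from equidistant parallel cuts, whose pieces contain copies of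
  the body contracted by \<open>1 / n\<close>; this also is the lower bound \<open>F C / n\<close> (\<open>fits_div\<close>).

  For balance, consider the first hyperplane of an optimal division and move it parallel to
  itself. The optimal values of the two halves are continuous and monotone in opposite directions,
  and at either end of the motion the value of the thin half is not the larger one. By the
  intermediate value theorem they agree for some position. There both equal the optimal value of
  the whole body: by monotonicity the common value is no smaller, and a larger one would contradict optimality. The
  halves are then balanced recursively (\<open>balanced_splits\<close>). Continuity is elementary: the
  value of the half up to height \<open>t\<close> above the lowest points increases with \<open>t\<close>, while its quotient
  by \<open>t\<close> decreases, since the half up to a smaller height contains a contracted copy of it
  (\<open>maxmin_value_cut_mono\<close>).

  The diameter is different, as it does not vanish on thin bodies. Cuts by hyperplanes through
  points near the ends of a diameter show that its optimal value is \<open>diameter C\<close>, whence every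
  piece of an optimal division has this diameter (\<open>maxmin_value_diameter\<close>). From dimension
  three on the hyperplanes can contain the segment itself, and the value is attained
  (\<open>splits_through_segment\<close>).

  The upper bound \<open>diameter C / 2\<close> for the width holds because the extents of the two halves of
  the first cut, measured along its normal, add up to at most the diameter.\<close>

section \<open>Cutting convex bodies\<close>

lemma interior_cut_le_subset:
  assumes "a \<noteq> 0"
  shows "interior (K \<inter> {x. a \<bullet> x \<le> b}) \<subseteq> {x. a \<bullet> x < b}"
  using assms interior_mono[of "K \<inter> {x. a \<bullet> x \<le> b}" "{x. a \<bullet> x \<le> b}"] by simp

lemma interior_cut_ge_subset:
  assumes "a \<noteq> 0"
  shows "interior (K \<inter> {x. a \<bullet> x \<ge> b}) \<subseteq> {x. a \<bullet> x > b}"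
  using assms interior_mono[of "K \<inter> {x. a \<bullet> x \<ge> b}" "{x. a \<bullet> x \<ge> b}"] by simp

lemma interior_cuts_disjoint:
  assumes "a \<noteq> 0"
  shows "interior (K \<inter> {x. a \<bullet> x \<le> b}) \<inter> interior (K \<inter> {x. a \<bullet> x \<ge> b}) = {}"
proof -
  have "{x. a \<bullet> x < b} \<inter> {x. a \<bullet> x > b} = {}"
    by auto
  then show ?thesis
    using interior_cut_le_subset[OF assms, of K b] interior_cut_ge_subset[OF assms, of K b] by blast
qed

lemma convex_body_imp_nonempty: "convex_body K \<Longrightarrow> K \<noteq> {}"
  by (auto simp: convex_body_def)

lemma convex_bodyD:
  assumes "convex_body K"
  shows "compact K" "convex K" "interior K \<noteq> {}" "K \<noteq> {}"
  using assms convex_body_imp_nonempty by (auto simp: convex_body_def)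

lemma convex_body_superset:
  assumes "convex_body K" "K \<subseteq> L" "compact L" "convex L"
  shows "convex_body L"
  using assms interior_mono[of K L] by (auto simp: convex_body_def)

lemma compact_cut: "compact K \<Longrightarrow> compact (K \<inter> {x. a \<bullet> x \<le> b})"
  and compact_cut': "compact K \<Longrightarrow> compact (K \<inter> {x. a \<bullet> x \<ge> b})"
  for a :: "'a::euclidean_space"
  by (simp_all add: compact_Int_closed closed_halfspace_le closed_halfspace_ge)

lemma convex_cut: "convex K \<Longrightarrow> convex (K \<inter> {x. a \<bullet> x \<le> b})"
  and convex_cut': "convex K \<Longrightarrow> convex (K \<inter> {x. a \<bullet> x \<ge> b})"
  for a :: "'a::euclidean_space"
  by (simp_all add: convex_Int convex_halfspace_le convex_halfspace_ge)

text \<open>A convex body is the closure of its interior, so a point of it strictly on one side of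
  a hyperplane forces interior points on that side.\<close>

lemma convex_body_cut:
  assumes K: "convex_body K" and x: "x \<in> K" "a \<bullet> x < b"
  shows "convex_body (K \<inter> {x. a \<bullet> x \<le> b})"
proof -
  have "x \<in> closure (interior K)"
    using K x(1) closure_subset by (auto simp: convex_body_def convex_closure_interior)
  with x(2) have "{x. a \<bullet> x < b} \<inter> closure (interior K) \<noteq> {}"
    by auto
  then have "{x. a \<bullet> x < b} \<inter> interior K \<noteq> {}"
    using open_Int_closure_eq_empty[OF open_halfspace_lt, of a b "interior K"] by blast
  moreover have "{x. a \<bullet> x < b} \<inter> interior K \<subseteq> interior (K \<inter> {x. a \<bullet> x \<le> b})"
    using interior_subset[of K] by (intro interior_maximal open_Int open_halfspace_lt) auto
  ultimately show ?thesis
    using K by (auto simp: convex_body_def compact_cut convex_cut)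
qed

lemma convex_body_cut':
  assumes "convex_body K" "x \<in> K" "a \<bullet> x > b"
  shows "convex_body (K \<inter> {x. a \<bullet> x \<ge> b})"
  using convex_body_cut[of K x "- a" "- b"] assms by simp

lemma convex_body_cut_interior:
  assumes K: "convex_body K" and z: "z \<in> interior K" and a: "a \<noteq> 0"
  shows "convex_body (K \<inter> {x. a \<bullet> x \<le> a \<bullet> z})"
    and "convex_body (K \<inter> {x. a \<bullet> x \<ge> a \<bullet> z})"
proof -
  obtain e where e: "e > 0" "cball z e \<subseteq> K"
    using z mem_interior_cball by blast
  define d where "d = e / norm a"
  have d: "d > 0" "norm (d *\<^sub>R a) = e"
    using e a by (auto simp: d_def)
  have "z - d *\<^sub>R a \<in> K" "z + d *\<^sub>R a \<in> K"
    using e d by (auto simp: dist_norm subset_iff)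
  moreover have "a \<bullet> (z - d *\<^sub>R a) < a \<bullet> z" "a \<bullet> z < a \<bullet> (z + d *\<^sub>R a)"
    using a d(1) by (auto simp: inner_simps)
  ultimately show "convex_body (K \<inter> {x. a \<bullet> x \<le> a \<bullet> z})"
    and "convex_body (K \<inter> {x. a \<bullet> x \<ge> a \<bullet> z})"
    using convex_body_cut[OF K] convex_body_cut'[OF K] by blast+
qed

section \<open>Divisions as binary trees of cuts\<close>

text \<open>A division is produced by cutting one of the current pieces at a time. Read from its
  first cut it is instead a binary tree: the first hyperplane separates \<open>K\<close> into two halves,
  each of which is divided on its own. In this form statements about divisions, with \<open>Q\<close> the
  property demanded of the pieces, have proofs by structural induction that never mention the
  set of pieces. The normals have unit length so that sequences of cuts subconverge.\<close>

inductive splits :: "('a::euclidean_space set \<Rightarrow> bool) \<Rightarrow> nat \<Rightarrow> 'a set \<Rightarrow> bool"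
  for Q where
  leaf: "splits Q 1 K" if "Q K"
| node: "splits Q (m + n) K"
  if "norm a = 1" "splits Q m (K \<inter> {x. a \<bullet> x \<le> b})" "splits Q n (K \<inter> {x. a \<bullet> x \<ge> b})"

lemma splits_pos: "splits Q n K \<Longrightarrow> 0 < n"
  by (induction rule: splits.induct) auto

lemma splits_mono:
  assumes "splits Q n K" "\<And>L. Q L \<Longrightarrow> Q' L"
  shows "splits Q' n K"
  using assms(1)
proof induction
  case (leaf K)
  then show ?case by (intro splits.leaf assms(2))
qed (rule splits.node)

lemma splits_leaf_subset:
  assumes "splits Q n K"
  obtains L where "L \<subseteq> K" "Q L"
proof -
  have "\<exists>L\<subseteq>K. Q L"
    using assms by induction blast+
  then show ?thesis
    using that by blast
qed

lemma splits_1_iff: "splits Q 1 K \<longleftrightarrow> Q K"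
proof
  assume "splits Q 1 K"
  then show "Q K"
  proof cases
    case (node a m b n)
    then show ?thesis
      using splits_pos[OF node(3)] splits_pos[OF node(4)] by simp
  qed auto
qed (rule leaf)

lemma splits_nodeE:
  assumes "splits Q n K" "n \<noteq> 1"
  obtains a b k l where "norm a = 1" "n = k + l" "0 < k" "0 < l"
    "splits Q k (K \<inter> {x. a \<bullet> x \<le> b})" "splits Q l (K \<inter> {x. a \<bullet> x \<ge> b})"
  using assms(1)
proof cases
  case leaf
  then show ?thesis using assms(2) by simp
next
  case (node a k b l)
  then show ?thesis using that splits_pos[OF node(3)] splits_pos[OF node(4)] by blast
qed

lemma splits_node_general:
  assumes a: "a \<noteq> 0"
    and le: "splits Q m (K \<inter> {x. a \<bullet> x \<le> b})" and ge: "splits Q n (K \<inter> {x. a \<bullet> x \<ge> b})"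
  shows "splits Q (m + n) K"
proof -
  have "{x. a \<bullet> x \<le> b} = {x. (a /\<^sub>R norm a) \<bullet> x \<le> b / norm a}"
    "{x. a \<bullet> x \<ge> b} = {x. (a /\<^sub>R norm a) \<bullet> x \<ge> b / norm a}"
    using a by (auto simp: field_simps)
  then show ?thesis
    using splits.node[of "a /\<^sub>R norm a" Q m K "b / norm a" n] a le ge by simp
qed

text \<open>Disjointness of the interiors is what keeps the pieces distinct, and hence their number
  equal to \<open>n\<close> although they form a set.\<close>

lemma is_division_facts:
  assumes "is_division C n P" "interior C \<noteq> {}"
  shows "finite P \<and> card P = n \<and> (\<forall>K\<in>P. interior K \<noteq> {} \<and> K \<subseteq> C) \<and>
    pairwise (\<lambda>K L. interior K \<inter> interior L = {}) P"
  using assms(1)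
proof induction
  case whole
  then show ?case using assms(2) by auto
next
  case (cut n P K a b)
  define A B where AB_def: "A = K \<inter> {x. a \<bullet> x \<le> b}" "B = K \<inter> {x. a \<bullet> x \<ge> b}"
  have AB: "interior A \<inter> interior B = {}"
    unfolding AB_def by (rule interior_cuts_disjoint) fact
  have sub: "interior A \<subseteq> interior K" "interior B \<subseteq> interior K"
    by (auto simp: AB_def intro!: interior_mono)
  have int: "interior A \<noteq> {}" "interior B \<noteq> {}"
    using cut.hyps by (simp_all add: AB_def)
  have disj: "interior K \<inter> interior L = {}" if "L \<in> P - {K}" for L
    using cut.IH cut.hyps(2) that pairwiseD[of _ P K L] by blast
  have new: "A \<notin> P - {K}" "B \<notin> P - {K}"
    using disj sub int by blast+
  have "A \<noteq> B"
    using AB int by (metis Int_absorb)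
  have "finite P" "card P = n"
    using cut.IH by blast+
  then have "card (insert A (insert B (P - {K}))) = Suc n"
    using new \<open>A \<noteq> B\<close> card.remove[OF \<open>finite P\<close> cut.hyps(2)] by simp
  moreover have "\<forall>L\<in>insert A (insert B (P - {K})). interior L \<noteq> {} \<and> L \<subseteq> C"
  proof -
    have "A \<subseteq> K" "B \<subseteq> K"
      by (auto simp: AB_def)
    then show ?thesis
      using cut.IH cut.hyps(2) int by blast
  qed
  moreover have "pairwise (\<lambda>K L. interior K \<inter> interior L = {}) (insert A (insert B (P - {K})))"
  proof -
    have "interior A \<inter> interior L = {} \<and> interior L \<inter> interior A = {}"
      "interior B \<inter> interior L = {} \<and> interior L \<inter> interior B = {}" if "L \<in> P - {K}" for L
      using disj[OF that] sub by blast+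
    moreover have "pairwise (\<lambda>K L. interior K \<inter> interior L = {}) (P - {K})"
      using cut.IH pairwise_subset[of _ P "P - {K}"] by blast
    moreover have "interior B \<inter> interior A = {}"
      using AB by blast
    ultimately show ?thesis
      using AB by (simp add: pairwise_insert) metis
  qed
  moreover have "finite (insert A (insert B (P - {K})))"
    using \<open>finite P\<close> by simp
  ultimately show ?case
    unfolding AB_def[symmetric] by (intro conjI)
qed

lemma is_division_convex_body:
  assumes "is_division C n P" "convex_body C" "K \<in> P"
  shows "convex_body K"
  using assms(1,3)
proof (induction arbitrary: K)
  case whole
  then show ?case using assms(2) by simp
next
  case (cut n P K a b L)
  then have "convex_body K" by blast
  then show ?case
    using cut by (auto simp: convex_body_def compact_cut compact_cut' convex_cut convex_cut')
qed

text \<open>A piece of the inner division cannot also be another piece of the outer one, since their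
  interiors are disjoint; so no piece is lost in the union and the numbers add up.\<close>

lemma is_division_refine:
  assumes P: "is_division C n P" and C: "interior C \<noteq> {}" and K: "K \<in> P"
    and Q: "is_division K m Q"
  shows "is_division C (n + m - 1) (P - {K} \<union> Q)"
  using Q
proof induction
  case whole
  then show ?case using P K by (simp add: insert_absorb)
next
  case (cut m Q L a b)
  have intK: "interior K \<noteq> {}"
    using is_division_facts[OF P C] K by blast
  have L: "interior L \<noteq> {}" "L \<subseteq> K" and "m > 0"
    using is_division_facts[OF cut.hyps(1) intK] cut.hyps(2) by (auto simp: card_gt_0_iff)
  have "L \<notin> P - {K}"
  proof
    assume "L \<in> P - {K}"
    then have "interior L \<inter> interior K = {}"
      using is_division_facts[OF P C] K pairwiseD[of _ P L K] by blast
    then show False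
      using L interior_mono[of L K] by blast
  qed
  then have "P - {K} \<union> Q - {L} = P - {K} \<union> (Q - {L})"
    by blast
  moreover have "is_division C (Suc (n + m - 1)) (insert (L \<inter> {x. a \<bullet> x \<le> b})
      (insert (L \<inter> {x. a \<bullet> x \<ge> b}) (P - {K} \<union> Q - {L})))"
    using cut by (intro is_division.cut) auto
  moreover have "Suc (n + m - 1) = n + Suc m - 1"
    using \<open>m > 0\<close> by simp
  ultimately show ?case
    by simp
qed

text \<open>Undoing the last cut merges the two newest pieces into their union, and the trees below
  them into one tree. The counting function \<open>h\<close> lets the pieces carry trees of any size, which
  is what the induction along the sequence of cuts requires.\<close>

lemma is_division_imp_splits:
  assumes "is_division C n P" "interior C \<noteq> {}" "\<forall>K\<in>P. splits Q (h K) K"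
  shows "splits Q (sum h P) C"
  using assms(1,3)
proof (induction arbitrary: h)
  case whole
  then show ?case by simp
next
  case (cut n P K a b)
  let ?A = "K \<inter> {x. a \<bullet> x \<le> b}" and ?B = "K \<inter> {x. a \<bullet> x \<ge> b}"
  define h' where "h' = h(K := h ?A + h ?B)"
  have P: "finite P" and disj: "\<And>L. L \<in> P - {K} \<Longrightarrow> interior K \<inter> interior L = {}"
    using is_division_facts[OF cut.hyps(1) assms(2)] cut.hyps(2) pairwiseD[of _ P K] by blast+
  have sub: "interior ?A \<subseteq> interior K" "interior ?B \<subseteq> interior K"
    by (auto intro!: interior_mono)
  have new: "?A \<notin> P - {K}" "?B \<notin> P - {K}"
    using disj sub cut.hyps by blast+
  have "?A \<noteq> ?B"
    using interior_cuts_disjoint[of a K b] cut.hyps by (metis Int_absorb)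
  have "splits Q (h' K) K"
    using splits_node_general[OF cut.hyps(3), of Q "h ?A" K b "h ?B"] cut.prems
    by (simp add: h'_def)
  then have "\<forall>L\<in>P. splits Q (h' L) L"
    using cut.prems by (auto simp: h'_def)
  then have "splits Q (sum h' P) C"
    by (rule cut.IH)
  also have "sum h' P = h' K + sum h' (P - {K})"
    using P cut.hyps(2) by (rule sum.remove)
  also have "sum h' (P - {K}) = sum h (P - {K})"
    by (auto simp: h'_def intro!: sum.cong)
  also have "h' K + sum h (P - {K}) = sum h (insert ?A (insert ?B (P - {K})))"
    using P new \<open>?A \<noteq> ?B\<close> by (simp add: h'_def)
  finally show ?case .
qed

lemma splits_imp_is_division:
  assumes "splits Q n K" and Q: "\<And>L. Q L \<Longrightarrow> interior L \<noteq> {}"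
  shows "\<exists>P. is_division K n P \<and> (\<forall>L\<in>P. Q L)"
  using assms(1)
proof induction
  case (leaf K)
  then show ?case using is_division.whole[of K] by auto
next
  case (node a m K b n)
  let ?A = "K \<inter> {x. a \<bullet> x \<le> b}" and ?B = "K \<inter> {x. a \<bullet> x \<ge> b}"
  have int: "interior ?A \<noteq> {}" "interior ?B \<noteq> {}"
    using node.hyps Q interior_mono by (metis splits_leaf_subset subset_empty)+
  then have K: "interior K \<noteq> {}"
    using interior_mono[of ?A K] by auto
  obtain P1 P2 where P1: "is_division ?A m P1" "\<forall>L\<in>P1. Q L"
    and P2: "is_division ?B n P2" "\<forall>L\<in>P2. Q L"
    using node.IH by blast
  have "a \<noteq> 0"
    using node.hyps by auto
  then have "?A \<noteq> ?B"
    using interior_cuts_disjoint[of a K b] int by (metis Int_absorb)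
  have "is_division K (Suc 1) (insert ?A (insert ?B ({K} - {K})))"
    using is_division.cut[OF is_division.whole _ \<open>a \<noteq> 0\<close> int] by simp
  from is_division_refine[OF this K _ P1(1)]
  have "is_division K (Suc m) ({?A, ?B} - {?A} \<union> P1)"
    by simp
  from is_division_refine[OF this K _ P2(1)] \<open>?A \<noteq> ?B\<close>
  have "is_division K (m + n) ({?A, ?B} - {?A} \<union> P1 - {?B} \<union> P2)"
    by simp
  then show ?case
    using P1(2) P2(2) by blast
qed

lemma splits_iff_is_division:
  assumes "interior K \<noteq> {}" and "\<And>L. Q L \<Longrightarrow> interior L \<noteq> {}"
  shows "splits Q n K \<longleftrightarrow> (\<exists>P. is_division K n P \<and> (\<forall>L\<in>P. Q L))"
proof
  assume "\<exists>P. is_division K n P \<and> (\<forall>L\<in>P. Q L)"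
  then obtain P where P: "is_division K n P" "\<forall>L\<in>P. Q L"
    by blast
  then have "\<forall>L\<in>P. splits Q 1 L"
    using splits_1_iff by blast
  from is_division_imp_splits[OF P(1) assms(1) this] show "splits Q n K"
    using is_division_facts[OF P(1) assms(1)] by simp
qed (use splits_imp_is_division assms(2) in blast)

section \<open>Size functionals and limits of divisions\<close>

text \<open>The Kuratowski upper limit: all limits of subsequences of points of the \<open>X j\<close>. Bounding
  it from above is all the convergence of sets that upper semicontinuity requires.\<close>

definition outer_limit :: "(nat \<Rightarrow> 'a::topological_space set) \<Rightarrow> 'a set" where
  "outer_limit X = {l. \<exists>r x. strict_mono r \<and> (\<forall>j. x j \<in> X (r j)) \<and> x \<longlonglongrightarrow> l}"

lemma outer_limitI:
  assumes "strict_mono r" "\<And>j. x j \<in> X (r j)" "x \<longlonglongrightarrow> l"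
  shows "l \<in> outer_limit X"
  using assms unfolding outer_limit_def by blast

lemma outer_limit_cut:
  fixes X :: "nat \<Rightarrow> 'a::euclidean_space set"
  assumes s: "strict_mono s" and a: "(\<lambda>j. a (s j)) \<longlonglongrightarrow> a0" and b: "(\<lambda>j. b (s j)) \<longlonglongrightarrow> b0"
  shows "outer_limit (\<lambda>j. X (s j) \<inter> {x. a (s j) \<bullet> x \<le> b (s j)}) \<subseteq> outer_limit X \<inter> {x. a0 \<bullet> x \<le> b0}"
proof
  fix l
  assume "l \<in> outer_limit (\<lambda>j. X (s j) \<inter> {x. a (s j) \<bullet> x \<le> b (s j)})"
  then obtain r x where r: "strict_mono r" and l: "x \<longlonglongrightarrow> l"
    and x: "\<And>j. x j \<in> X (s (r j))" "\<And>j. a (s (r j)) \<bullet> x j \<le> b (s (r j))"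
    by (auto simp: outer_limit_def)
  have "strict_mono (\<lambda>j. s (r j))"
    using s r by (simp add: strict_mono_def)
  then have "l \<in> outer_limit X"
    using x(1) l by (rule outer_limitI)
  moreover have "a0 \<bullet> l \<le> b0"
  proof (rule LIMSEQ_le)
    show "(\<lambda>j. a (s (r j)) \<bullet> x j) \<longlonglongrightarrow> a0 \<bullet> l"
      using LIMSEQ_subseq_LIMSEQ[OF a r] l by (intro tendsto_inner) (simp_all add: o_def)
    show "(\<lambda>j. b (s (r j))) \<longlonglongrightarrow> b0"
      using LIMSEQ_subseq_LIMSEQ[OF b r] by (simp add: o_def)
  qed (use x(2) in auto)
  ultimately show "l \<in> outer_limit X \<inter> {x. a0 \<bullet> x \<le> b0}"
    by simp
qed

lemma outer_limit_cut':
  fixes X :: "nat \<Rightarrow> 'a::euclidean_space set"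
  assumes s: "strict_mono s" and a: "(\<lambda>j. a (s j)) \<longlonglongrightarrow> a0" and b: "(\<lambda>j. b (s j)) \<longlonglongrightarrow> b0"
  shows "outer_limit (\<lambda>j. X (s j) \<inter> {x. a (s j) \<bullet> x \<ge> b (s j)}) \<subseteq> outer_limit X \<inter> {x. a0 \<bullet> x \<ge> b0}"
  using outer_limit_cut[OF s, of "\<lambda>j. - a j" "- a0" "\<lambda>j. - b j" "- b0" X] a b
  by (simp add: tendsto_minus)

lemma outer_limit_const:
  assumes "closed K"
  shows "outer_limit (\<lambda>_. K) \<subseteq> K"
  using closed_sequentially[OF assms] by (auto simp: outer_limit_def)

definition homothety :: "'a::real_vector \<Rightarrow> real \<Rightarrow> 'a \<Rightarrow> 'a" where
  "homothety p r x = p + r *\<^sub>R (x - p)"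

lemma homothety_image_cut:
  fixes a :: "'a::euclidean_space"
  assumes "r > 0"
  shows "homothety p r ` (K \<inter> {x. a \<bullet> x \<le> b}) =
      homothety p r ` K \<inter> {x. a \<bullet> x \<le> a \<bullet> p + r * (b - a \<bullet> p)}"
    and "homothety p r ` (K \<inter> {x. a \<bullet> x \<ge> b}) =
      homothety p r ` K \<inter> {x. a \<bullet> x \<ge> a \<bullet> p + r * (b - a \<bullet> p)}"
  using assms by (auto simp: homothety_def inner_simps)

lemma homothety_image_subset:
  assumes "convex K" "p \<in> K" "0 \<le> r" "r \<le> 1"
  shows "homothety p r ` K \<subseteq> K"
proof
  fix y
  assume "y \<in> homothety p r ` K"
  then obtain x where x: "x \<in> K" "y = (1 - r) *\<^sub>R p + r *\<^sub>R x"
    by (auto simp: homothety_def algebra_simps)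
  then show "y \<in> K"
    using assms by (auto intro: convexD)
qed

lemma homothety_eq: "homothety p r = (+) (p - r *\<^sub>R p) \<circ> (*\<^sub>R) r"
  by (auto simp: homothety_def algebra_simps)

lemma convex_body_homothety:
  fixes K :: "'a::euclidean_space set"
  assumes K: "convex_body K" and r: "r > 0"
  shows "convex_body (homothety p r ` K)"
proof -
  have "homothety p r ` K = (+) (p - r *\<^sub>R p) ` ((*\<^sub>R) r ` K)"
    unfolding homothety_eq image_comp by simp
  moreover have "interior ((*\<^sub>R) r ` K) = (*\<^sub>R) r ` interior K"
    using r by (intro interior_injective_linear_image) (auto simp: inj_on_def intro: linear_scaleR)
  ultimately show ?thesis
    using K by (auto simp: convex_body_def compact_translation compact_scaling convex_translation
        convex_scaling interior_translation)
qed

text \<open>Since \<open>f t / (t - m)\<close> decreases, \<open>f\<close> cannot grow faster than linearly: it differs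
  from \<open>f t0\<close> by at most \<open>\<bar>t - t0\<bar>\<close> times \<open>f t0 / (t0 - m)\<close>.\<close>

lemma continuous_on_mono_sublinear:
  fixes f :: "real \<Rightarrow> real"
  assumes mono: "\<And>s t. m < s \<Longrightarrow> s \<le> t \<Longrightarrow> f s \<le> f t"
    and sub: "\<And>s t. m < s \<Longrightarrow> s \<le> t \<Longrightarrow> (s - m) * f t \<le> (t - m) * f s"
  shows "continuous_on {m<..} f"
proof (rule continuous_on_eq_continuous_at[THEN iffD2, rule_format])
  fix t0
  assume "t0 \<in> {m<..}"
  then have t0: "m < t0" by simp
  have bound: "\<bar>f t - f t0\<bar> \<le> f t0 / (t0 - m) * \<bar>t - t0\<bar>" if t: "m < t" for t
  proof (cases "t0 \<le> t")
    case True
    then show ?thesis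
      using mono[OF t0 True] sub[OF t0 True] t0 by (simp add: field_simps)
  next
    case False
    then show ?thesis
      using mono[OF t, of t0] sub[OF t, of t0] t0 by (simp add: field_simps)
  qed
  have "((\<lambda>t. f t - f t0) \<longlongrightarrow> 0) (at t0)"
  proof (rule Lim_null_comparison)
    show "\<forall>\<^sub>F t in at t0. norm (f t - f t0) \<le> f t0 / (t0 - m) * \<bar>t - t0\<bar>"
      using eventually_at_in_open'[OF open_greaterThan, of t0 m] t0
      by (auto elim!: eventually_mono dest!: bound)
    have "((\<lambda>t. f t0 / (t0 - m) * \<bar>t - t0\<bar>) \<longlongrightarrow> f t0 / (t0 - m) * \<bar>t0 - t0\<bar>) (at t0)"
      by (intro tendsto_intros)
    then show "((\<lambda>t. f t0 / (t0 - m) * \<bar>t - t0\<bar>) \<longlongrightarrow> 0) (at t0)"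
      by simp
  qed
  then show "isCont f t0"
    unfolding isCont_def by (rule LIM_zero_cancel)
qed simp

text \<open>The properties shared by the width and the inradius on which the existence of balanced
  optimal divisions rests. The diameter does not tend to zero on bodies that become thin, so it
  violates \<open>le_width\<close>, and also that the limit \<open>K\<close> in \<open>upper_semicontinuous\<close> has interior
  points; this is why it needs separate treatment.\<close>

locale size_functional =
  fixes F :: "'a::euclidean_space set \<Rightarrow> real"
  assumes mono: "\<lbrakk>convex_body K; convex_body L; K \<subseteq> L\<rbrakk> \<Longrightarrow> F K \<le> F L"
    and pos: "convex_body K \<Longrightarrow> 0 < F K"
    and homothety_le: "\<lbrakk>convex_body K; 0 < r\<rbrakk> \<Longrightarrow> r * F K \<le> F (homothety p r ` K)"
    and le_width: "\<lbrakk>convex_body K; norm a = 1; \<And>x. x \<in> K \<Longrightarrow> s \<le> a \<bullet> x \<and> a \<bullet> x \<le> t\<rbrakk>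
      \<Longrightarrow> F K \<le> t - s"
    and upper_semicontinuous:
      "\<lbrakk>\<And>j. convex_body (X j); \<And>j. c j \<le> F (X j); bounded (\<Union>j. X j); c \<longlonglongrightarrow> c0; 0 < c0;
        outer_limit X \<subseteq> K; compact K; convex K\<rbrakk> \<Longrightarrow> convex_body K \<and> c0 \<le> F K"
begin

definition fits :: "real \<Rightarrow> nat \<Rightarrow> 'a set \<Rightarrow> bool" where
  "fits c n K \<longleftrightarrow> splits (\<lambda>L. convex_body L \<and> c \<le> F L) n K"

lemma fits_1_iff: "fits c 1 K \<longleftrightarrow> convex_body K \<and> c \<le> F K"
  unfolding fits_def by (rule splits_1_iff)

lemma fits_nodeI:
  assumes "norm a = 1" "fits c k (K \<inter> {x. a \<bullet> x \<le> b})" "fits c l (K \<inter> {x. a \<bullet> x \<ge> b})"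
  shows "fits c (k + l) K"
  using assms unfolding fits_def by (rule splits.node)

lemma fits_nodeE:
  assumes "fits c n K" "n \<noteq> 1"
  obtains a b k l where "norm a = 1" "n = k + l" "0 < k" "0 < l"
    "fits c k (K \<inter> {x. a \<bullet> x \<le> b})" "fits c l (K \<inter> {x. a \<bullet> x \<ge> b})"
  using assms unfolding fits_def by (rule splits_nodeE)

lemma fits_antimono: "fits c n K \<Longrightarrow> c' \<le> c \<Longrightarrow> fits c' n K"
  unfolding fits_def by (erule splits_mono) auto

lemma fits_convex_body:
  assumes "fits c n K" "compact K" "convex K"
  shows "convex_body K"
proof -
  obtain L where "L \<subseteq> K" "convex_body L"
    using assms(1) unfolding fits_def by (rule splits_leaf_subset) auto
  then show ?thesis
    using convex_body_superset assms(2,3) by blast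
qed

lemma fits_nonempty: "fits c n K \<Longrightarrow> K \<noteq> {}"
  unfolding fits_def by (erule splits_leaf_subset) (auto dest: convex_body_imp_nonempty)

lemma fits_le:
  assumes "fits c n K" "convex_body K"
  shows "c \<le> F K"
proof -
  obtain L where "L \<subseteq> K" "convex_body L" "c \<le> F L"
    using assms(1) unfolding fits_def by (rule splits_leaf_subset) auto
  then show ?thesis
    using mono[of L K] assms(2) by simp
qed

text \<open>The same hyperplanes divide a larger body into larger pieces.\<close>

lemma fits_superset:
  assumes "fits c n K" "K \<subseteq> L" "compact L" "convex L"
  shows "fits c n L"
  using assms unfolding fits_def
proof (induction arbitrary: L)
  case (leaf K)
  then have "convex_body L"
    using convex_body_superset by blast
  with leaf mono[of K L] show ?case
    by (intro splits.leaf) auto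
next
  case (node a m K b n)
  show ?case
  proof (rule splits.node)
    show "norm a = 1" by fact
    show "splits (\<lambda>L. convex_body L \<and> c \<le> F L) m (L \<inter> {x. a \<bullet> x \<le> b})"
      using node.prems by (intro node.IH) (auto simp: compact_cut convex_cut)
    show "splits (\<lambda>L. convex_body L \<and> c \<le> F L) n (L \<inter> {x. a \<bullet> x \<ge> b})"
      using node.prems by (intro node.IH) (auto simp: compact_cut' convex_cut')
  qed
qed

lemma fits_homothety:
  assumes "fits c n K" "0 < r"
  shows "fits (r * c) n (homothety p r ` K)"
  using assms(1) unfolding fits_def
proof induction
  case (leaf K)
  have "r * c \<le> r * F K"
    using leaf assms(2) by simp
  also have "\<dots> \<le> F (homothety p r ` K)"
    using leaf assms(2) homothety_le by blast
  finally show ?case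
    using leaf assms(2) convex_body_homothety by (intro splits.leaf) auto
next
  case (node a m K b n)
  then show ?case
    using assms(2)
    by (intro splits.node[of a _ _ _ "a \<bullet> p + r * (b - a \<bullet> p)"]) (auto simp: homothety_image_cut)
qed

text \<open>This is the compactness of the space of divisions. After passing to a subsequence, the
  number of pieces on either side of the first hyperplane is constant and the hyperplanes
  converge; the limit hyperplane then cuts \<open>K\<close> into halves that contain the upper limits of the
  two sequences of halves, and the argument repeats in each of them. Degenerate limit pieces are
  ruled out at the leaves by \<open>c0 > 0\<close>.\<close>

lemma fits_limit:
  assumes "\<And>j. fits (c j) n (X j)" "bounded (\<Union>j. X j)" "c \<longlonglongrightarrow> c0" "0 < c0"
    "outer_limit X \<subseteq> K" "compact K" "convex K"
  shows "fits c0 n K"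
  using assms(1-3,5-7)
proof (induction n arbitrary: c X K rule: less_induct)
  case (less n)
  show ?case
  proof (cases "n = 1")
    case True
    have "convex_body K \<and> c0 \<le> F K"
      using less.prems assms(4) unfolding True fits_1_iff by (intro upper_semicontinuous[of X c]) auto
    then show ?thesis
      unfolding True fits_1_iff .
  next
    case False
    have "\<forall>j. \<exists>a b k l. norm a = 1 \<and> n = k + l \<and> 0 < k \<and> 0 < l \<and>
        fits (c j) k (X j \<inter> {x. a \<bullet> x \<le> b}) \<and> fits (c j) l (X j \<inter> {x. a \<bullet> x \<ge> b})"
    proof
      fix j
      show "\<exists>a b k l. norm a = 1 \<and> n = k + l \<and> 0 < k \<and> 0 < l \<and>
          fits (c j) k (X j \<inter> {x. a \<bullet> x \<le> b}) \<and> fits (c j) l (X j \<inter> {x. a \<bullet> x \<ge> b})"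
        using less.prems(1)[of j] False by (rule fits_nodeE) blast
    qed
    then obtain a b k l where a: "\<And>j. norm (a j) = 1"
      and n: "\<And>j. n = k j + l j" "\<And>j. 0 < k j" "\<And>j. 0 < l j"
      and fle: "\<And>j. fits (c j) (k j) (X j \<inter> {x. a j \<bullet> x \<le> b j})"
      and fge: "\<And>j. fits (c j) (l j) (X j \<inter> {x. a j \<bullet> x \<ge> b j})"
      by metis
    have "finite (range k)"
    proof (rule finite_subset)
      have "k j \<le> n" for j
        using n(1)[of j] by simp
      then show "range k \<subseteq> {..n}"
        by auto
    qed simp
    then obtain j0 where "infinite {j. k j = k j0}"
      using pigeonhole_infinite[of UNIV k] by auto
    then obtain r :: "nat \<Rightarrow> nat" where r: "strict_mono r" "\<forall>j. r j \<in> {j. k j = k j0}"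
      using infinite_enumerate[of "{j. k j = k j0}"] by blast
    then have kr: "k (r j) = k j0" for j
      by simp
    then have lr: "l (r j) = l j0" for j
      using n(1)[of "r j"] n(1)[of j0] by simp
    obtain R where R: "\<And>j x. x \<in> X j \<Longrightarrow> norm x \<le> R"
      using less.prems(2) by (auto simp: bounded_iff)
    have "b j \<in> {- R..R}" for j
    proof -
      obtain x y where "x \<in> X j" "a j \<bullet> x \<le> b j" "y \<in> X j" "b j \<le> a j \<bullet> y"
        using fits_nonempty[OF fle[of j]] fits_nonempty[OF fge[of j]] by blast
      moreover have "\<bar>a j \<bullet> x\<bar> \<le> norm x" "\<bar>a j \<bullet> y\<bar> \<le> norm y"
        using Cauchy_Schwarz_ineq2[of "a j" x] Cauchy_Schwarz_ineq2[of "a j" y] a by simp_all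
      ultimately show ?thesis
        using R[of x j] R[of y j] by auto
    qed
    then have "\<forall>j. (\<lambda>j. (a (r j), b (r j))) j \<in> sphere 0 1 \<times> {- R..R}"
      using a by simp
    with compact_imp_seq_compact[OF compact_Times[OF compact_sphere compact_Icc]]
    obtain p and q :: "nat \<Rightarrow> nat" where p: "p \<in> sphere 0 1 \<times> {- R..R}" and q: "strict_mono q"
      and lim: "((\<lambda>j. (a (r j), b (r j))) \<circ> q) \<longlonglongrightarrow> p"
      by (rule seq_compactE)
    define s where "s = r \<circ> q"
    have s: "strict_mono s"
      using r(1) q unfolding s_def by (rule strict_mono_o)
    have as: "(\<lambda>j. a (s j)) \<longlonglongrightarrow> fst p" and bs: "(\<lambda>j. b (s j)) \<longlonglongrightarrow> snd p"
      using tendsto_fst[OF lim] tendsto_snd[OF lim] by (simp_all add: s_def o_def)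
    have ks: "k (s j) = k j0" "l (s j) = l j0" for j
      using kr lr by (simp_all add: s_def)
    have cs: "(\<lambda>j. c (s j)) \<longlonglongrightarrow> c0"
      using LIMSEQ_subseq_LIMSEQ[OF less.prems(3) s] by (simp add: o_def)
    have "fits c0 (k j0) (K \<inter> {x. fst p \<bullet> x \<le> snd p})"
    proof (rule less.IH[of _ "\<lambda>j. c (s j)" "\<lambda>j. X (s j) \<inter> {x. a (s j) \<bullet> x \<le> b (s j)}"])
      show "k j0 < n"
        using n[of j0] by simp
      show "fits (c (s j)) (k j0) (X (s j) \<inter> {x. a (s j) \<bullet> x \<le> b (s j)})" for j
        using fle[of "s j"] ks by simp
      show "bounded (\<Union>j. X (s j) \<inter> {x. a (s j) \<bullet> x \<le> b (s j)})"
        by (rule bounded_subset[OF less.prems(2)]) auto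
      show "outer_limit (\<lambda>j. X (s j) \<inter> {x. a (s j) \<bullet> x \<le> b (s j)}) \<subseteq> K \<inter> {x. fst p \<bullet> x \<le> snd p}"
        using outer_limit_cut[where X = X, OF s as bs] less.prems(4) by blast
    qed (use cs less.prems in \<open>auto simp: compact_cut convex_cut\<close>)
    moreover have "fits c0 (l j0) (K \<inter> {x. fst p \<bullet> x \<ge> snd p})"
    proof (rule less.IH[of _ "\<lambda>j. c (s j)" "\<lambda>j. X (s j) \<inter> {x. a (s j) \<bullet> x \<ge> b (s j)}"])
      show "l j0 < n"
        using n[of j0] by simp
      show "fits (c (s j)) (l j0) (X (s j) \<inter> {x. a (s j) \<bullet> x \<ge> b (s j)})" for j
        using fge[of "s j"] ks by simp
      show "bounded (\<Union>j. X (s j) \<inter> {x. a (s j) \<bullet> x \<ge> b (s j)})"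
        by (rule bounded_subset[OF less.prems(2)]) auto
      show "outer_limit (\<lambda>j. X (s j) \<inter> {x. a (s j) \<bullet> x \<ge> b (s j)}) \<subseteq> K \<inter> {x. fst p \<bullet> x \<ge> snd p}"
        using outer_limit_cut'[where X = X, OF s as bs] less.prems(4) by blast
    qed (use cs less.prems in \<open>auto simp: compact_cut' convex_cut'\<close>)
    moreover have "norm (fst p) = 1"
      using p by (auto simp: mem_Times_iff)
    ultimately show ?thesis
      using fits_nodeI n(1)[of j0] by metis
  qed
qed

text \<open>Equidistant parallel cuts, in recursive form: the hyperplane at relative height \<open>1 / n\<close>
  between two supporting hyperplanes leaves the copy of \<open>K\<close> contracted by \<open>1 / n\<close> towards a
  lowest point on one side, and on the other the copy contracted by \<open>1 - 1 / n\<close> towards a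
  highest point.\<close>

lemma fits_div:
  assumes "convex_body K" "0 < n"
  shows "fits (F K / real n) n K"
  using assms(2,1)
proof (induction n arbitrary: K rule: nat_induct_non_zero)
  case 1
  then show ?case by (simp add: fits_1_iff[simplified])
next
  case (Suc n K)
  have K: "compact K" "convex K" "K \<noteq> {}"
    using Suc.prems convex_body_imp_nonempty by (auto simp: convex_body_def)
  obtain e :: 'a where e: "norm e = 1"
    using vector_choose_size[of 1] by auto
  have cont: "continuous_on K ((\<bullet>) e)"
    by (intro continuous_intros)
  obtain p where p: "p \<in> K" "\<And>x. x \<in> K \<Longrightarrow> e \<bullet> p \<le> e \<bullet> x"
    using continuous_attains_inf[OF K(1,3) cont] by blast
  obtain q where q: "q \<in> K" "\<And>x. x \<in> K \<Longrightarrow> e \<bullet> x \<le> e \<bullet> q"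
    using continuous_attains_sup[OF K(1,3) cont] by blast
  define r where "r = 1 / real (Suc n)"
  have r: "0 < r" "0 < 1 - r" "r < 1"
    using Suc.hyps by (simp_all add: r_def field_simps)
  define b where "b = e \<bullet> p + r * (e \<bullet> q - e \<bullet> p)"
  have "fits (r * F K) 1 (homothety p r ` K)"
    using homothety_le convex_body_homothety Suc.prems r unfolding fits_1_iff by blast
  then have lo: "fits (r * F K) 1 (K \<inter> {x. e \<bullet> x \<le> b})"
  proof (rule fits_superset)
    have "homothety p r ` K \<subseteq> K"
      using K p r by (intro homothety_image_subset) auto
    moreover have "e \<bullet> homothety p r x \<le> b" if "x \<in> K" for x
      using q(2)[OF that] r by (auto simp: homothety_def b_def inner_simps)
    ultimately show "homothety p r ` K \<subseteq> K \<inter> {x. e \<bullet> x \<le> b}"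
      by auto
  qed (use K in \<open>auto simp: compact_cut convex_cut\<close>)
  have "(1 - r) * (F K / real n) = r * F K"
    using Suc.hyps by (simp add: r_def field_simps)
  then have "fits (r * F K) n (homothety q (1 - r) ` K)"
    using fits_homothety[OF Suc.IH[OF Suc.prems] r(2), of q] by simp
  then have hi: "fits (r * F K) n (K \<inter> {x. e \<bullet> x \<ge> b})"
  proof (rule fits_superset)
    have "homothety q (1 - r) ` K \<subseteq> K"
      using K q r by (intro homothety_image_subset) auto
    moreover have "b \<le> e \<bullet> homothety q (1 - r) x" if "x \<in> K" for x
    proof -
      have "e \<bullet> homothety q (1 - r) x - b = (1 - r) * (e \<bullet> x - e \<bullet> p)"
        by (simp add: homothety_def b_def inner_simps algebra_simps)
      then show ?thesis
        using p(2)[OF that] r by (smt (verit) mult_nonneg_nonneg)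
    qed
    ultimately show "homothety q (1 - r) ` K \<subseteq> K \<inter> {x. e \<bullet> x \<ge> b}"
      by auto
  qed (use K in \<open>auto simp: compact_cut' convex_cut'\<close>)
  show ?case
    using fits_nodeI[OF e lo hi] by (simp add: r_def)
qed

lemma le_min_value_iff:
  assumes "is_division C n P" "interior C \<noteq> {}" "0 < n"
  shows "c \<le> min_value F P \<longleftrightarrow> (\<forall>K\<in>P. c \<le> F K)"
proof -
  have "finite P" "P \<noteq> {}"
    using is_division_facts[OF assms(1,2)] assms(3) by auto
  then show ?thesis
    by (simp add: min_value_def)
qed

lemma fits_iff_is_division:
  assumes "convex_body K" "0 < n"
  shows "fits c n K \<longleftrightarrow> (\<exists>P. is_division K n P \<and> c \<le> min_value F P)"
proof -
  have int: "interior K \<noteq> {}"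
    using assms(1) by (simp add: convex_body_def)
  have "fits c n K \<longleftrightarrow> (\<exists>P. is_division K n P \<and> (\<forall>L\<in>P. convex_body L \<and> c \<le> F L))"
    unfolding fits_def using int by (rule splits_iff_is_division) (simp add: convex_body_def)
  also have "\<dots> \<longleftrightarrow> (\<exists>P. is_division K n P \<and> c \<le> min_value F P)"
    using is_division_convex_body[OF _ assms(1)] le_min_value_iff[OF _ int assms(2)] by blast
  finally show ?thesis .
qed

text \<open>Taking \<open>c\<close> to be the supremum itself shows that it is attained.\<close>

theorem le_maxmin_value_iff:
  assumes K: "convex_body K" and n: "0 < n"
  shows "c \<le> maxmin_value F n K \<longleftrightarrow> fits c n K"
proof -
  define V where "V = {min_value F P | P. is_division K n P}"
  have fits_V: "fits c n K \<longleftrightarrow> (\<exists>v\<in>V. c \<le> v)" for c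
    unfolding fits_iff_is_division[OF K n] V_def by blast
  have m: "maxmin_value F n K = Sup V"
    by (simp add: maxmin_value_def V_def)
  have bdd: "bdd_above V"
    using fits_V fits_le[OF _ K] by (meson bdd_aboveI order_refl)
  obtain v where v: "v \<in> V" "F K / real n \<le> v"
    using fits_V fits_div[OF K n] by blast
  have "0 < F K / real n"
    using pos[OF K] n by simp
  also have "\<dots> \<le> Sup V"
    using v cSup_upper[OF v(1) bdd] by simp
  finally have Vpos: "0 < Sup V" .
  have "fits (Sup V) n K"
  proof (rule fits_limit)
    define c where "c = (\<lambda>j. Sup V - inverse (real (Suc j)))"
    show "c \<longlonglongrightarrow> Sup V"
      unfolding c_def using tendsto_diff[OF tendsto_const LIMSEQ_inverse_real_of_nat, of "Sup V"] by simp
    have "c j < Sup V" for j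
      by (simp add: c_def)
    then show "fits (c j) n K" for j
      using fits_V v(1) less_cSup_iff[of V] bdd by (metis empty_iff less_imp_le)
    show "outer_limit (\<lambda>j. K) \<subseteq> K"
      using K by (intro outer_limit_const compact_imp_closed) (simp add: convex_body_def)
  qed (use Vpos K in \<open>auto simp: convex_body_def compact_imp_bounded\<close>)
  then have "fits c n K" if "c \<le> Sup V"
    using that fits_antimono by blast
  moreover have "c \<le> Sup V" if "fits c n K"
    using that fits_V cSup_upper[OF _ bdd] by (meson order_trans)
  ultimately show ?thesis
    unfolding m by blast
qed

section \<open>Balancing an optimal division\<close>

text \<open>Moving the cutting hyperplane parallel to itself changes the optimal values of the two
  halves continuously: contracting the larger half towards a lowest point of \<open>K\<close> puts it inside
  the smaller one, so the value divided by the height above the lowest point decreases.\<close>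

lemma maxmin_value_cut_mono:
  assumes K: "convex_body K" and n: "0 < n" and p: "p \<in> K"
    and st: "a \<bullet> p < s" "s \<le> t"
  shows "maxmin_value F n (K \<inter> {x. a \<bullet> x \<le> s}) \<le> maxmin_value F n (K \<inter> {x. a \<bullet> x \<le> t})"
    and "(s - a \<bullet> p) * maxmin_value F n (K \<inter> {x. a \<bullet> x \<le> t}) \<le>
      (t - a \<bullet> p) * maxmin_value F n (K \<inter> {x. a \<bullet> x \<le> s})"
proof -
  let ?S = "K \<inter> {x. a \<bullet> x \<le> s}" and ?T = "K \<inter> {x. a \<bullet> x \<le> t}"
  have S: "convex_body ?S" and T: "convex_body ?T"
    using convex_body_cut[OF K p] st by auto
  have S': "compact ?S" "convex ?S" and T': "compact ?T" "convex ?T"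
    using S T by (auto simp: convex_body_def)
  have "fits (maxmin_value F n ?S) n ?S"
    using le_maxmin_value_iff[OF S n] by blast
  then have "fits (maxmin_value F n ?S) n ?T"
    using st T' by (elim fits_superset) auto
  then show "maxmin_value F n ?S \<le> maxmin_value F n ?T"
    using le_maxmin_value_iff[OF T n] by blast
  define r where "r = (s - a \<bullet> p) / (t - a \<bullet> p)"
  have r: "0 < r" "r \<le> 1" "r * (t - a \<bullet> p) = s - a \<bullet> p"
    using st by (auto simp: r_def)
  have "fits (maxmin_value F n ?T) n ?T"
    using le_maxmin_value_iff[OF T n] by blast
  then have "fits (r * maxmin_value F n ?T) n (homothety p r ` ?T)"
    using r by (intro fits_homothety)
  then have "fits (r * maxmin_value F n ?T) n ?S"
  proof (rule fits_superset)
    have "homothety p r ` ?T = homothety p r ` K \<inter> {x. a \<bullet> x \<le> s}"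
      using r by (simp add: homothety_image_cut)
    moreover have "homothety p r ` K \<subseteq> K"
      using K p r by (intro homothety_image_subset) (auto simp: convex_body_def)
    ultimately show "homothety p r ` ?T \<subseteq> ?S"
      by blast
  qed (fact S')+
  then have "r * maxmin_value F n ?T \<le> maxmin_value F n ?S"
    using le_maxmin_value_iff[OF S n] by blast
  then show "(s - a \<bullet> p) * maxmin_value F n ?T \<le> (t - a \<bullet> p) * maxmin_value F n ?S"
    using st by (simp add: r_def field_simps)
qed

lemma continuous_on_maxmin_value_cut:
  assumes "convex_body K" "0 < n" "p \<in> K"
  shows "continuous_on {a \<bullet> p<..} (\<lambda>t. maxmin_value F n (K \<inter> {x. a \<bullet> x \<le> t}))"
  using maxmin_value_cut_mono[OF assms] by (intro continuous_on_mono_sublinear) auto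

lemma maxmin_value_le_width:
  assumes "convex_body K" "0 < n" "norm a = 1" "\<And>x. x \<in> K \<Longrightarrow> s \<le> a \<bullet> x \<and> a \<bullet> x \<le> t"
  shows "maxmin_value F n K \<le> t - s"
proof -
  have "maxmin_value F n K \<le> F K"
    using fits_le le_maxmin_value_iff assms(1,2) by blast
  then show ?thesis
    using le_width[OF assms(1,3,4)] by simp
qed

text \<open>Moving the first hyperplane trades the optimal values \<open>f\<close> and \<open>g\<close> of the two halves
  against each other. At the ends of the range of motion one half is too thin to exceed the
  optimum of \<open>K\<close> while the other still reaches it, so \<open>f\<close> and \<open>g\<close> agree somewhere in
  between. The common value is not below the optimum, by monotonicity, and not above it, since both halves could then be divided better. So
  each half has the optimum of \<open>K\<close> as its own optimal value, and induction balances it.\<close>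

theorem balanced_splits:
  assumes "convex_body K" "0 < n"
  shows "splits (\<lambda>L. convex_body L \<and> F L = maxmin_value F n K) n K"
  using assms
proof (induction n arbitrary: K rule: less_induct)
  case (less n)
  define c where "c = maxmin_value F n K"
  have fits_c: "fits c n K" and c_max: "\<And>c'. fits c' n K \<Longrightarrow> c' \<le> c"
    using le_maxmin_value_iff[OF less.prems] by (auto simp: c_def)
  have K: "compact K" "convex K" "K \<noteq> {}"
    using less.prems convex_body_imp_nonempty by (auto simp: convex_body_def)
  show ?case
  proof (cases "n = 1")
    case True
    have "c \<le> F K" "F K \<le> c"
      using fits_c c_max[of "F K"] less.prems unfolding True fits_1_iff by auto
    then show ?thesis
      using less.prems splits.leaf[of "\<lambda>L. convex_body L \<and> F L = c" K] by (simp add: True c_def)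
  next
    case False
    obtain a b k l where a: "norm a = 1" and n: "n = k + l" "0 < k" "0 < l"
      and fk: "fits c k (K \<inter> {x. a \<bullet> x \<le> b})" and fl: "fits c l (K \<inter> {x. a \<bullet> x \<ge> b})"
      using fits_c False by (rule fits_nodeE)
    have cont: "continuous_on K ((\<bullet>) a)"
      by (intro continuous_intros)
    obtain p where p: "p \<in> K" "\<And>x. x \<in> K \<Longrightarrow> a \<bullet> p \<le> a \<bullet> x"
      using continuous_attains_inf[OF K(1,3) cont] by blast
    obtain q where q: "q \<in> K" "\<And>x. x \<in> K \<Longrightarrow> a \<bullet> x \<le> a \<bullet> q"
      using continuous_attains_sup[OF K(1,3) cont] by blast
    define f where "f = (\<lambda>t. maxmin_value F k (K \<inter> {x. a \<bullet> x \<le> t}))"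
    define g where "g = (\<lambda>t. maxmin_value F l (K \<inter> {x. a \<bullet> x \<ge> t}))"
    have g_eq: "g = (\<lambda>t. maxmin_value F l (K \<inter> {x. (- a) \<bullet> x \<le> - t}))"
      by (simp add: g_def)
    have lo: "convex_body (K \<inter> {x. a \<bullet> x \<le> t})" if "a \<bullet> p < t" for t
      using convex_body_cut[OF less.prems(1) p(1) that] .
    have hi: "convex_body (K \<inter> {x. a \<bullet> x \<ge> t})" if "t < a \<bullet> q" for t
      using convex_body_cut'[OF less.prems(1) q(1) that] .
    have f_mono: "f s \<le> f t" if "a \<bullet> p < s" "s \<le> t" for s t
      unfolding f_def using maxmin_value_cut_mono(1)[OF less.prems(1) n(2) p(1) that] .
    have g_mono: "g t \<le> g s" if "t < a \<bullet> q" "s \<le> t" for s t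
      unfolding g_eq using that
      by (intro maxmin_value_cut_mono(1)[OF less.prems(1) n(3) q(1)]) auto
    have f_cont: "continuous_on {a \<bullet> p<..} f"
      unfolding f_def using less.prems(1) n(2) p(1) by (rule continuous_on_maxmin_value_cut)
    have g_cont: "continuous_on {..<a \<bullet> q} g"
    proof -
      have "continuous_on {..<a \<bullet> q} ((\<lambda>t. maxmin_value F l (K \<inter> {x. (- a) \<bullet> x \<le> t})) \<circ> uminus)"
      proof (rule continuous_on_compose)
        show "continuous_on (uminus ` {..<a \<bullet> q}) (\<lambda>t. maxmin_value F l (K \<inter> {x. (- a) \<bullet> x \<le> t}))"
          by (rule continuous_on_subset[OF continuous_on_maxmin_value_cut[OF less.prems(1) n(3) q(1)]])
            auto
      qed (intro continuous_intros)
      then show ?thesis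
        by (simp add: g_eq o_def)
    qed
    have c_pos: "0 < c"
    proof -
      have "0 < F K / real n"
        using pos less.prems by simp
      then show ?thesis
        using c_max[OF fits_div[OF less.prems]] by simp
    qed
    have cb_lo: "convex_body (K \<inter> {x. a \<bullet> x \<le> b})" and cb_hi: "convex_body (K \<inter> {x. a \<bullet> x \<ge> b})"
      using fits_convex_body[OF fk] fits_convex_body[OF fl] K
      by (auto simp: compact_cut convex_cut compact_cut' convex_cut')
    have fb: "c \<le> f b" and gb: "c \<le> g b"
      using fk fl le_maxmin_value_iff[OF cb_lo n(2)] le_maxmin_value_iff[OF cb_hi n(3)]
      by (simp_all add: f_def g_def)
    have f_small: "f t \<le> t - a \<bullet> p" if "convex_body (K \<inter> {x. a \<bullet> x \<le> t})" for t
      unfolding f_def using p by (intro maxmin_value_le_width[OF that n(2) a]) auto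
    have g_small: "g t \<le> a \<bullet> q - t" if "convex_body (K \<inter> {x. a \<bullet> x \<ge> t})" for t
      unfolding g_def using q by (intro maxmin_value_le_width[OF that n(3) a]) auto
    \<comment> \<open>At \<open>t1\<close> and \<open>t2\<close> one of the halves lies in a slab of thickness \<open>c\<close>, so its value is at
      most \<open>c\<close>; staying between them also keeps both halves non-degenerate.\<close>
    define t1 t2 where "t1 = a \<bullet> p + c" and "t2 = a \<bullet> q - c"
    have t1b: "t1 \<le> b" and bt2: "b \<le> t2"
      using f_small[OF cb_lo] g_small[OF cb_hi] fb gb by (simp_all add: t1_def t2_def)
    have range: "a \<bullet> p < t \<and> t < a \<bullet> q" if "t \<in> {t1..t2}" for t
      using that c_pos by (auto simp: t1_def t2_def)
    have t12: "t1 \<in> {t1..t2}" "t2 \<in> {t1..t2}" "b \<in> {t1..t2}"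
      using t1b bt2 by auto
    have "f t1 - g t1 \<le> 0"
    proof -
      have "f t1 \<le> c"
        using f_small[OF lo[of t1]] range[OF t12(1)] by (simp add: t1_def)
      also have "c \<le> g t1"
        using gb g_mono[of b t1] range[OF t12(3)] t1b by simp
      finally show ?thesis by simp
    qed
    moreover have "0 \<le> f t2 - g t2"
    proof -
      have "g t2 \<le> c"
        using g_small[OF hi[of t2]] range[OF t12(2)] by (simp add: t2_def)
      also have "c \<le> f t2"
        using fb f_mono[of b t2] range[OF t12(3)] bt2 by simp
      finally show ?thesis by simp
    qed
    moreover have "continuous_on {t1..t2} (\<lambda>t. f t - g t)"
      using range by (intro continuous_on_diff continuous_on_subset[OF f_cont]
          continuous_on_subset[OF g_cont]) auto
    ultimately obtain t where t: "t1 \<le> t" "t \<le> t2" and fg: "f t - g t = 0"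
      using IVT'[of "\<lambda>t. f t - g t" t1 0 t2] t12 by auto
    have pt: "a \<bullet> p < t" and tq: "t < a \<bullet> q"
      using range[of t] t by auto
    have "c \<le> f t"
    proof (cases "b \<le> t")
      case True
      then show ?thesis using fb f_mono[of b t] range[OF t12(3)] by simp
    next
      case False
      then show ?thesis using gb g_mono[of b t] range[OF t12(3)] fg by simp
    qed
    moreover have "f t \<le> c"
    proof (rule c_max)
      have "fits (f t) k (K \<inter> {x. a \<bullet> x \<le> t})" "fits (f t) l (K \<inter> {x. a \<bullet> x \<ge> t})"
        using le_maxmin_value_iff[OF lo[OF pt] n(2)] le_maxmin_value_iff[OF hi[OF tq] n(3)] fg
        by (auto simp: f_def g_def)
      then show "fits (f t) n K"
        unfolding n(1) using a fits_nodeI by blast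
    qed
    ultimately have ft: "f t = c" and gt: "g t = c"
      using fg by auto
    have "splits (\<lambda>L. convex_body L \<and> F L = c) k (K \<inter> {x. a \<bullet> x \<le> t})"
      using less.IH[OF _ lo[OF pt] n(2)] ft n by (simp add: f_def)
    moreover have "splits (\<lambda>L. convex_body L \<and> F L = c) l (K \<inter> {x. a \<bullet> x \<ge> t})"
      using less.IH[OF _ hi[OF tq] n(3)] gt n by (simp add: g_def)
    ultimately have "splits (\<lambda>L. convex_body L \<and> F L = c) (k + l) K"
      by (rule splits.node[OF a])
    then show ?thesis
      by (simp only: c_def n(1))
  qed
qed

theorem ex_balanced_optimal_division:
  assumes K: "convex_body K" and n: "0 < n"
  shows "\<exists>P. optimal_division F n K P \<and> balanced F P"
proof -
  have int: "interior K \<noteq> {}"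
    using K by (simp add: convex_body_def)
  obtain P where P: "is_division K n P" "\<forall>L\<in>P. convex_body L \<and> F L = maxmin_value F n K"
    using splits_imp_is_division[OF balanced_splits[OF K n]] by (auto simp: convex_body_def)
  have "P \<noteq> {}"
    using is_division_facts[OF P(1) int] n by auto
  then have "F ` P = {maxmin_value F n K}"
    using P(2) by auto
  then have "min_value F P = maxmin_value F n K"
    by (simp add: min_value_def)
  then show ?thesis
    using P by (auto simp: optimal_division_def balanced_def)
qed

lemma maxmin_value_ge_div:
  assumes "convex_body K" "0 < n"
  shows "F K / real n \<le> maxmin_value F n K"
  using fits_div le_maxmin_value_iff assms by blast

lemma maxmin_value_le:
  assumes "convex_body K" "0 < n"
  shows "maxmin_value F n K \<le> F K"
  using fits_le le_maxmin_value_iff assms by blast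

text \<open>The two halves separated by the first hyperplane have, in the direction of its normal,
  widths that add up to at most the diameter, so one of them is at most half of it.\<close>

lemma maxmin_value_le_half_diameter:
  assumes K: "convex_body K" and n: "2 \<le> n"
  shows "maxmin_value F n K \<le> diameter K / 2"
proof -
  define c where "c = maxmin_value F n K"
  have K': "compact K" "convex K" "K \<noteq> {}"
    using K convex_body_imp_nonempty by (auto simp: convex_body_def)
  have "fits c n K" "n \<noteq> 1"
    using le_maxmin_value_iff[OF K, of n c] n by (auto simp: c_def)
  then obtain a b k l where a: "norm a = 1"
    and fk: "fits c k (K \<inter> {x. a \<bullet> x \<le> b})" and fl: "fits c l (K \<inter> {x. a \<bullet> x \<ge> b})"
    by (rule fits_nodeE)
  have cont: "continuous_on K ((\<bullet>) a)"
    by (intro continuous_intros)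
  obtain p where p: "p \<in> K" "\<And>x. x \<in> K \<Longrightarrow> a \<bullet> p \<le> a \<bullet> x"
    using continuous_attains_inf[OF K'(1,3) cont] by blast
  obtain q where q: "q \<in> K" "\<And>x. x \<in> K \<Longrightarrow> a \<bullet> x \<le> a \<bullet> q"
    using continuous_attains_sup[OF K'(1,3) cont] by blast
  have cb: "convex_body (K \<inter> {x. a \<bullet> x \<le> b})" "convex_body (K \<inter> {x. a \<bullet> x \<ge> b})"
    using fits_convex_body[OF fk] fits_convex_body[OF fl] K'
    by (auto simp: compact_cut convex_cut compact_cut' convex_cut')
  have "c \<le> b - a \<bullet> p"
    using fits_le[OF fk cb(1)] le_width[OF cb(1) a, of "a \<bullet> p" b] p by simp
  moreover have "c \<le> a \<bullet> q - b"
    using fits_le[OF fl cb(2)] le_width[OF cb(2) a, of b "a \<bullet> q"] q by simp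
  moreover have "a \<bullet> q - a \<bullet> p \<le> diameter K"
  proof -
    have "a \<bullet> q - a \<bullet> p = a \<bullet> (q - p)"
      by (simp add: inner_simps)
    also have "\<dots> \<le> norm a * norm (q - p)"
      by (rule norm_cauchy_schwarz)
    also have "\<dots> = dist q p"
      using a by (simp add: dist_norm)
    also have "\<dots> \<le> diameter K"
      using K' p q by (intro diameter_bounded_bound compact_imp_bounded)
    finally show ?thesis .
  qed
  ultimately show ?thesis
    by (simp add: c_def)
qed

end

section \<open>Minimal width\<close>

lemma setdist_parallel_hyperplanes:
  fixes a :: "'a::euclidean_space"
  assumes a: "a \<noteq> 0" and bc: "b \<le> c"
  shows "setdist {x. a \<bullet> x = b} {x. a \<bullet> x = c} = (c - b) / norm a"
proof (rule antisym)
  let ?x = "(b / (a \<bullet> a)) *\<^sub>R a" and ?y = "(c / (a \<bullet> a)) *\<^sub>R a"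
  have mem: "?x \<in> {x. a \<bullet> x = b}" "?y \<in> {x. a \<bullet> x = c}"
    using a by auto
  have "dist ?x ?y = norm ((b / (a \<bullet> a) - c / (a \<bullet> a)) *\<^sub>R a)"
    by (simp add: dist_norm scaleR_diff_left)
  also have "\<dots> = \<bar>b - c\<bar> / (norm a)\<^sup>2 * norm a"
    by (simp add: dot_square_norm diff_divide_distrib[symmetric])
  also have "\<dots> = (c - b) / norm a"
    using a bc by (simp add: power2_eq_square)
  finally show "setdist {x. a \<bullet> x = b} {x. a \<bullet> x = c} \<le> (c - b) / norm a"
    using setdist_le_dist[OF mem] by simp
  show "(c - b) / norm a \<le> setdist {x. a \<bullet> x = b} {x. a \<bullet> x = c}"
  proof (rule le_setdistI)
    fix x y
    assume "x \<in> {x. a \<bullet> x = b}" "y \<in> {x. a \<bullet> x = c}"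
    then have "c - b = a \<bullet> (y - x)"
      by (simp add: inner_simps)
    also have "\<dots> \<le> norm a * dist x y"
      using norm_cauchy_schwarz[of a "y - x"] by (simp add: dist_norm norm_minus_commute)
    finally show "(c - b) / norm a \<le> dist x y"
      using a by (simp add: field_simps)
  qed (use mem in blast)+
qed

text \<open>A lower bound on the width is witnessed, in each direction, by two points of the set. In
  this form it passes to larger sets, homothetic copies and limits.\<close>

lemma le_min_width_iff:
  fixes S :: "'a::euclidean_space set"
  assumes S: "compact S" "S \<noteq> {}"
  shows "c \<le> min_width S \<longleftrightarrow> (\<forall>u. norm u = 1 \<longrightarrow> (\<exists>x\<in>S. \<exists>y\<in>S. c \<le> u \<bullet> (y - x)))"
    (is "_ \<longleftrightarrow> ?R")
proof -
  define W where "W = {setdist H1 H2 | H1 H2. parallel_supporting_hyperplanes S H1 H2}"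
  have mw: "min_width S = Inf W"
    by (simp add: min_width_def W_def)
  have W_I: "\<exists>x\<in>S. \<exists>y\<in>S. u \<bullet> (y - x) \<in> W" if u: "norm u = 1" for u
  proof -
    have cont: "continuous_on S ((\<bullet>) u)"
      by (intro continuous_intros)
    obtain p where p: "p \<in> S" "\<And>x. x \<in> S \<Longrightarrow> u \<bullet> p \<le> u \<bullet> x"
      using continuous_attains_inf[OF S cont] by blast
    obtain q where q: "q \<in> S" "\<And>x. x \<in> S \<Longrightarrow> u \<bullet> x \<le> u \<bullet> q"
      using continuous_attains_sup[OF S cont] by blast
    have u0: "u \<noteq> 0"
      using u by auto
    then have "parallel_supporting_hyperplanes S {x. u \<bullet> x = u \<bullet> p} {x. u \<bullet> x = u \<bullet> q}"
      unfolding parallel_supporting_hyperplanes_def using p q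
      by (intro exI[of _ u] exI[of _ "u \<bullet> p"] exI[of _ "u \<bullet> q"]) auto
    moreover have "setdist {x. u \<bullet> x = u \<bullet> p} {x. u \<bullet> x = u \<bullet> q} = u \<bullet> (q - p)"
      using setdist_parallel_hyperplanes[OF u0, of "u \<bullet> p" "u \<bullet> q"] p(2)[OF q(1)] u
      by (simp add: inner_diff_right)
    ultimately have "u \<bullet> (q - p) \<in> W"
      unfolding W_def by force
    then show ?thesis
      using p(1) q(1) by blast
  qed
  have W_D: "\<exists>u. norm u = 1 \<and> (\<forall>x\<in>S. \<forall>y\<in>S. u \<bullet> (y - x) \<le> w)" if "w \<in> W" for w
  proof -
    from that have "\<exists>H1 H2. w = setdist H1 H2 \<and> parallel_supporting_hyperplanes S H1 H2"
      unfolding W_def by (rule CollectD)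
    then obtain H1 H2 where H: "w = setdist H1 H2" "parallel_supporting_hyperplanes S H1 H2"
      by blast
    from H(2) obtain a b d where a: "a \<noteq> 0" and "H1 = {x. a \<bullet> x = b}" "H2 = {x. a \<bullet> x = d}"
      and sub: "S \<subseteq> {x. b \<le> a \<bullet> x \<and> a \<bullet> x \<le> d}"
      unfolding parallel_supporting_hyperplanes_def by (elim exE conjE)
    with H(1) have w: "w = setdist {x. a \<bullet> x = b} {x. a \<bullet> x = d}"
      by simp
    have "b \<le> d"
      using sub S(2) by force
    then have w: "w = (d - b) / norm a"
      using setdist_parallel_hyperplanes[OF a] w by simp
    have "(a /\<^sub>R norm a) \<bullet> (y - x) \<le> w" if "x \<in> S" "y \<in> S" for x y
    proof -
      have "b \<le> a \<bullet> x" "a \<bullet> y \<le> d"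
        using that sub by auto
      then have "a \<bullet> (y - x) \<le> d - b"
        by (simp add: inner_simps)
      then show ?thesis
        using a by (simp add: w field_simps)
    qed
    then show ?thesis
      using a by (intro exI[of _ "a /\<^sub>R norm a"]) auto
  qed
  obtain e :: 'a where "norm e = 1"
    using vector_choose_size[of 1] by auto
  then have "W \<noteq> {}"
    using W_I by blast
  moreover have bdd: "bdd_below W"
    by (rule bdd_belowI[of _ 0]) (auto simp: W_def setdist_pos_le)
  ultimately have "c \<le> min_width S \<longleftrightarrow> (\<forall>w\<in>W. c \<le> w)"
    unfolding mw by (rule le_cInf_iff)
  also have "\<dots> \<longleftrightarrow> ?R"
  proof
    assume "\<forall>w\<in>W. c \<le> w"
    then show ?R
      using W_I by blast
  next
    assume R: ?R
    show "\<forall>w\<in>W. c \<le> w"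
    proof
      fix w
      assume "w \<in> W"
      then obtain u where u: "norm u = 1" "\<forall>x\<in>S. \<forall>y\<in>S. u \<bullet> (y - x) \<le> w"
        using W_D by blast
      then obtain x y where "x \<in> S" "y \<in> S" "c \<le> u \<bullet> (y - x)"
        using R by blast
      then show "c \<le> w"
        using u(2) by force
    qed
  qed
  finally show ?thesis .
qed

lemma min_width_attained:
  fixes S :: "'a::euclidean_space set"
  assumes "compact S" "S \<noteq> {}" "norm u = 1"
  obtains x y where "x \<in> S" "y \<in> S" "min_width S \<le> u \<bullet> (y - x)"
  using le_min_width_iff[OF assms(1,2), of "min_width S"] assms(3) by auto

lemma min_width_mono:
  fixes S :: "'a::euclidean_space set"
  assumes "compact S" "S \<noteq> {}" "S \<subseteq> T" "compact T"
  shows "min_width S \<le> min_width T"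
proof -
  have "T \<noteq> {}"
    using assms by blast
  then show ?thesis
    using assms le_min_width_iff[OF assms(4), of "min_width S"] min_width_attained[OF assms(1,2)]
    by (metis subsetD)
qed

lemma min_width_ge_cball:
  fixes x :: "'a::euclidean_space"
  assumes "cball x r \<subseteq> S" "0 \<le> r" "compact S"
  shows "2 * r \<le> min_width S"
proof -
  have "2 * r \<le> min_width (cball x r)"
  proof (subst le_min_width_iff)
    show "\<forall>u. norm u = 1 \<longrightarrow> (\<exists>p\<in>cball x r. \<exists>q\<in>cball x r. 2 * r \<le> u \<bullet> (q - p))"
    proof (intro allI impI)
      fix u :: 'a
      assume u: "norm u = 1"
      then have "u \<bullet> u = 1"
        by (simp add: dot_square_norm)
      then have "2 * r \<le> u \<bullet> ((x + r *\<^sub>R u) - (x - r *\<^sub>R u))"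
        by (simp add: inner_simps)
      moreover have "x - r *\<^sub>R u \<in> cball x r" "x + r *\<^sub>R u \<in> cball x r"
        using u assms(2) by (simp_all add: dist_norm)
      ultimately show "\<exists>p\<in>cball x r. \<exists>q\<in>cball x r. 2 * r \<le> u \<bullet> (q - p)"
        by blast
    qed
  qed (use assms(2) in auto)
  also have "\<dots> \<le> min_width S"
    using assms by (intro min_width_mono) auto
  finally show ?thesis .
qed

lemma min_width_le_slab:
  fixes S :: "'a::euclidean_space set"
  assumes S: "compact S" "S \<noteq> {}" and u: "norm u = 1"
    and slab: "\<And>x. x \<in> S \<Longrightarrow> s \<le> u \<bullet> x \<and> u \<bullet> x \<le> t"
  shows "min_width S \<le> t - s"
proof -
  obtain x y where "x \<in> S" "y \<in> S" "min_width S \<le> u \<bullet> (y - x)"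
    using min_width_attained[OF S u] .
  then show ?thesis
    using slab[of x] slab[of y] by (simp add: inner_diff_right)
qed

text \<open>For upper semicontinuity, the points realising the extent of \<open>X j\<close> in a fixed direction
  have convergent subsequences, whose limits lie in \<open>K\<close>. A set without interior points lies in a
  hyperplane, hence has width zero; so the limit is again a body.\<close>

interpretation width: size_functional "min_width :: 'a::euclidean_space set \<Rightarrow> real"
proof
  fix K L :: "'a set"
  assume "convex_body K" "convex_body L" "K \<subseteq> L"
  then show "min_width K \<le> min_width L"
    by (intro min_width_mono convex_bodyD)
next
  fix K :: "'a set"
  assume K: "convex_body K"
  then obtain x e where "0 < e" "cball x e \<subseteq> K"
    using convex_bodyD(3) mem_interior_cball by blast
  then show "0 < min_width K"
    using min_width_ge_cball[of x e K] convex_bodyD(1)[OF K] by simp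
next
  fix K :: "'a set" and r and p :: 'a
  assume K: "convex_body K" and r: "0 < (r::real)"
  let ?h = "homothety p r"
  have "\<exists>x\<in>?h ` K. \<exists>y\<in>?h ` K. r * min_width K \<le> u \<bullet> (y - x)" if u: "norm u = 1" for u
  proof -
    obtain x y where xy: "x \<in> K" "y \<in> K" "min_width K \<le> u \<bullet> (y - x)"
      using min_width_attained[OF convex_bodyD(1,4)[OF K] u] .
    have "?h y - ?h x = r *\<^sub>R (y - x)"
      by (simp add: homothety_def algebra_simps)
    then have "u \<bullet> (?h y - ?h x) = r * (u \<bullet> (y - x))"
      by simp
    then have "r * min_width K \<le> u \<bullet> (?h y - ?h x)"
      using xy(3) r by simp
    then show ?thesis
      using xy by blast
  qed
  then show "r * min_width K \<le> min_width (?h ` K)"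
    using le_min_width_iff[OF convex_bodyD(1,4)[OF convex_body_homothety[OF K r]]] by simp
next
  fix K :: "'a set" and a s t
  assume K: "convex_body K" and "norm a = 1" "\<And>x. x \<in> K \<Longrightarrow> s \<le> a \<bullet> x \<and> a \<bullet> x \<le> t"
  then show "min_width K \<le> t - s"
    by (intro min_width_le_slab convex_bodyD[OF K])
next
  fix X :: "nat \<Rightarrow> 'a set" and c c0 K
  assume X: "\<And>j. convex_body (X j)" and cX: "\<And>j. c j \<le> min_width (X j)"
    and bdd: "bounded (\<Union>j. X j)" and c: "c \<longlonglongrightarrow> c0" "0 < c0"
    and lim: "outer_limit X \<subseteq> K" and K: "compact K" "convex K"
  have wide: "\<exists>x\<in>K. \<exists>y\<in>K. c0 \<le> u \<bullet> (y - x)" if u: "norm u = 1" for u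
  proof -
    have "\<exists>x y. x \<in> X j \<and> y \<in> X j \<and> c j \<le> u \<bullet> (y - x)" for j
    proof -
      obtain x y where "x \<in> X j" "y \<in> X j" "min_width (X j) \<le> u \<bullet> (y - x)"
        using min_width_attained[OF convex_bodyD(1,4)[OF X] u] .
      then show ?thesis
        using cX[of j] order_trans by blast
    qed
    then obtain x y where xy: "\<And>j. x j \<in> X j" "\<And>j. y j \<in> X j" "\<And>j. c j \<le> u \<bullet> (y j - x j)"
      by metis
    have "bounded (range (\<lambda>j. (x j, y j)))"
      by (rule bounded_subset[OF bounded_Times[OF bdd bdd]]) (use xy in auto)
    then obtain l r where r: "strict_mono r" and l: "((\<lambda>j. (x j, y j)) \<circ> r) \<longlonglongrightarrow> l"
      using bounded_imp_convergent_subsequence by blast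
    have lx: "(\<lambda>j. x (r j)) \<longlonglongrightarrow> fst l" and ly: "(\<lambda>j. y (r j)) \<longlonglongrightarrow> snd l"
      using tendsto_fst[OF l] tendsto_snd[OF l] by (simp_all add: o_def)
    have "fst l \<in> K" "snd l \<in> K"
      using outer_limitI[OF r _ lx, of X] outer_limitI[OF r _ ly, of X] xy lim by auto
    moreover have "c0 \<le> u \<bullet> (snd l - fst l)"
    proof (rule LIMSEQ_le)
      show "(\<lambda>j. c (r j)) \<longlonglongrightarrow> c0"
        using LIMSEQ_subseq_LIMSEQ[OF c(1) r] by (simp add: o_def)
      show "(\<lambda>j. u \<bullet> (y (r j) - x (r j))) \<longlonglongrightarrow> u \<bullet> (snd l - fst l)"
        by (intro tendsto_intros lx ly)
    qed (use xy(3) in auto)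
    ultimately show ?thesis
      by blast
  qed
  have "interior K \<noteq> {}"
  proof
    assume "interior K = {}"
    then obtain a b where ab: "a \<noteq> 0" "K \<subseteq> {x. a \<bullet> x = b}"
      using empty_interior_subset_hyperplane[OF K(2)] by blast
    then obtain x y where "x \<in> K" "y \<in> K" "c0 \<le> (a /\<^sub>R norm a) \<bullet> (y - x)"
      using wide[of "a /\<^sub>R norm a"] by auto
    moreover from this ab have "a \<bullet> (y - x) = 0"
      by (auto simp: inner_simps)
    ultimately show False
      using c(2) by simp
  qed
  then have "convex_body K"
    using K by (simp add: convex_body_def)
  then show "convex_body K \<and> c0 \<le> min_width K"
    using wide le_min_width_iff[OF convex_bodyD(1,4)[of K]] by simp
qed

section \<open>Inradius\<close>

text \<open>Limits of inscribed balls are inscribed in the limit. For a constant sequence of sets this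
  says that the inradius is attained.\<close>

lemma cball_outer_limit:
  fixes X :: "nat \<Rightarrow> 'a::euclidean_space set"
  assumes ball: "\<And>j. cball (x j) (r j) \<subseteq> X j" and r: "\<And>j. 0 \<le> r j" "r \<longlonglongrightarrow> r0" "0 \<le> r0"
    and bdd: "bounded (\<Union>j. X j)" and lim: "outer_limit X \<subseteq> K"
  shows "\<exists>z. cball z r0 \<subseteq> K"
proof -
  have mem: "x j + r j *\<^sub>R v \<in> X j" if "norm v \<le> 1" for j v
    using ball[of j] r(1)[of j] mult_left_le[OF that r(1)[of j]] by (auto simp: dist_norm subset_iff)
  have "bounded (range x)"
    by (rule bounded_subset[OF bdd]) (use mem[of 0] in auto)
  then obtain z s where s: "strict_mono s" and z: "(x \<circ> s) \<longlonglongrightarrow> z"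
    using bounded_imp_convergent_subsequence by blast
  have rs: "(\<lambda>j. r (s j)) \<longlonglongrightarrow> r0"
    using LIMSEQ_subseq_LIMSEQ[OF r(2) s] by (simp add: o_def)
  have "z + r0 *\<^sub>R v \<in> K" if v: "norm v \<le> 1" for v
  proof -
    have "(\<lambda>j. x (s j) + r (s j) *\<^sub>R v) \<longlonglongrightarrow> z + r0 *\<^sub>R v"
      using z rs by (intro tendsto_intros) (simp_all add: o_def)
    then show ?thesis
      using outer_limitI[OF s, of "\<lambda>j. x (s j) + r (s j) *\<^sub>R v" X] mem[OF v] lim by blast
  qed
  moreover have "\<exists>v. norm v \<le> 1 \<and> y = z + r0 *\<^sub>R v" if "y \<in> cball z r0" for y
  proof (cases "r0 = 0")
    case True
    then show ?thesis using that by (intro exI[of _ 0]) auto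
  next
    case False
    then have "norm ((y - z) /\<^sub>R r0) = dist z y / r0"
      using r(3) by (simp add: dist_norm norm_minus_commute[of z] divide_inverse mult.commute
          del: scaleR_diff_right)
    also have "\<dots> \<le> 1"
      using that r(3) False by simp
    finally show ?thesis
      using False by (intro exI[of _ "(y - z) /\<^sub>R r0"]) simp
  qed
  ultimately show ?thesis
    by blast
qed

lemma bdd_above_radii:
  fixes S :: "'a::euclidean_space set"
  assumes "bounded S"
  shows "bdd_above {r. 0 \<le> r \<and> (\<exists>x. cball x r \<subseteq> S)}"
proof (rule bdd_aboveI[of _ "diameter S / 2"])
  fix r
  assume "r \<in> {r. 0 \<le> r \<and> (\<exists>x. cball x r \<subseteq> S)}"
  then obtain x where "0 \<le> r" "cball x r \<subseteq> S"
    by blast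
  then show "r \<le> diameter S / 2"
    using diameter_subset[of "cball x r" S] assms by simp
qed

lemma inradius_ge:
  fixes S :: "'a::euclidean_space set"
  assumes "bounded S" "0 \<le> r" "cball x r \<subseteq> S"
  shows "r \<le> inradius S"
  unfolding inradius_def using assms by (intro cSup_upper bdd_above_radii) blast

lemma inradius_attained:
  fixes S :: "'a::euclidean_space set"
  assumes S: "compact S" "S \<noteq> {}"
  shows "0 \<le> inradius S" and "\<exists>x. cball x (inradius S) \<subseteq> S"
proof -
  define V where "V = {r. 0 \<le> r \<and> (\<exists>x. cball x r \<subseteq> S)}"
  have V: "inradius S = Sup V" "bdd_above V"
    using bdd_above_radii compact_imp_bounded[OF S(1)] by (auto simp: inradius_def V_def)
  obtain x where "x \<in> S"
    using S by blast
  then have "0 \<in> V"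
    by (auto simp: V_def)
  then show nonneg: "0 \<le> inradius S"
    unfolding V(1) using V(2) by (rule cSup_upper)
  have "Sup V \<in> closure V"
    using \<open>0 \<in> V\<close> V(2) by (intro closure_contains_Sup) auto
  then obtain r where r: "\<And>j. r j \<in> V" "r \<longlonglongrightarrow> Sup V"
    unfolding closure_sequential by blast
  then have "\<exists>x. cball x (r j) \<subseteq> S" for j
    by (auto simp: V_def)
  then obtain x where "\<And>j. cball (x j) (r j) \<subseteq> S"
    by metis
  then show "\<exists>x. cball x (inradius S) \<subseteq> S"
    using r nonneg S outer_limit_const[OF compact_imp_closed[OF S(1)]] unfolding V(1)
    by (intro cball_outer_limit[of x r "\<lambda>_. S"]) (auto simp: V_def compact_imp_bounded)
qed

interpretation inradius: size_functional "inradius :: 'a::euclidean_space set \<Rightarrow> real"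
proof
  fix K L :: "'a set"
  assume K: "convex_body K" and L: "convex_body L" and "K \<subseteq> L"
  then show "inradius K \<le> inradius L"
    using inradius_attained[OF convex_bodyD(1,4)[OF K]] convex_bodyD(1)[OF L]
    by (meson compact_imp_bounded inradius_ge order_trans)
next
  fix K :: "'a set"
  assume K: "convex_body K"
  then obtain x e where "0 < e" "cball x e \<subseteq> K"
    using convex_bodyD(3) mem_interior_cball by blast
  then show "0 < inradius K"
    using inradius_ge[of K e x] convex_bodyD(1)[OF K] compact_imp_bounded by fastforce
next
  fix K :: "'a set" and r and p :: 'a
  assume K: "convex_body K" and r: "0 < (r::real)"
  obtain x where x: "cball x (inradius K) \<subseteq> K" and nonneg: "0 \<le> inradius K"
    using inradius_attained[OF convex_bodyD(1,4)[OF K]] by blast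
  have "cball (homothety p r x) (r * inradius K) \<subseteq> homothety p r ` K"
  proof
    fix y
    assume y: "y \<in> cball (homothety p r x) (r * inradius K)"
    define z where "z = p + (y - p) /\<^sub>R r"
    have y_eq: "y = homothety p r z"
      using r by (simp add: z_def homothety_def)
    have "dist (homothety p r x) (homothety p r z) = norm (r *\<^sub>R (x - z))"
      by (simp add: dist_norm homothety_def algebra_simps)
    then have "dist (homothety p r x) (homothety p r z) = r * dist x z"
      using r by (simp add: dist_norm)
    then have "z \<in> K"
      using x y r by (auto simp: y_eq)
    then show "y \<in> homothety p r ` K"
      by (simp add: y_eq)
  qed
  then show "r * inradius K \<le> inradius (homothety p r ` K)"
    using r nonneg convex_bodyD(1)[OF convex_body_homothety[OF K r]]
    by (intro inradius_ge compact_imp_bounded) auto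
next
  fix K :: "'a set" and a s t
  assume K: "convex_body K" and a: "norm a = 1" and slab: "\<And>x. x \<in> K \<Longrightarrow> s \<le> a \<bullet> x \<and> a \<bullet> x \<le> t"
  obtain x where "cball x (inradius K) \<subseteq> K" "0 \<le> inradius K"
    using inradius_attained[OF convex_bodyD(1,4)[OF K]] by blast
  then have "2 * inradius K \<le> min_width K" "0 \<le> inradius K"
    using min_width_ge_cball convex_bodyD(1)[OF K] by auto
  moreover have "min_width K \<le> t - s"
    using convex_bodyD(1,4)[OF K] a slab by (rule min_width_le_slab)
  ultimately show "inradius K \<le> t - s"
    by simp
next
  fix X :: "nat \<Rightarrow> 'a set" and c c0 K
  assume X: "\<And>j. convex_body (X j)" and cX: "\<And>j. c j \<le> inradius (X j)"
    and bdd: "bounded (\<Union>j. X j)" and c: "c \<longlonglongrightarrow> c0" "0 < c0"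
    and lim: "outer_limit X \<subseteq> K" and K: "compact K" "convex K"
  have "\<exists>x. cball x (max (c j) 0) \<subseteq> X j" for j
  proof -
    obtain x where "cball x (inradius (X j)) \<subseteq> X j" "0 \<le> inradius (X j)"
      using inradius_attained[OF convex_bodyD(1,4)[OF X[of j]]] by blast
    moreover have "cball x (max (c j) 0) \<subseteq> cball x (inradius (X j))"
      using cX[of j] calculation(2) by (intro subset_cball) simp
    ultimately show ?thesis
      by blast
  qed
  then obtain x where "\<And>j. cball (x j) (max (c j) 0) \<subseteq> X j"
    by metis
  moreover have "(\<lambda>j. max (c j) 0) \<longlonglongrightarrow> c0"
    using tendsto_max[OF c(1) tendsto_const, of 0] c(2) by simp
  ultimately obtain z where z: "cball z c0 \<subseteq> K"
    using cball_outer_limit[of x "\<lambda>j. max (c j) 0" X c0 K] bdd lim c(2) by auto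
  then have "ball z c0 \<subseteq> interior K"
    using ball_subset_cball by (intro interior_maximal) blast+
  then have "interior K \<noteq> {}"
    using c(2) by auto
  then show "convex_body K \<and> c0 \<le> inradius K"
    using K z c(2) inradius_ge[of K c0 z] compact_imp_bounded by (auto simp: convex_body_def)
qed

section \<open>Diameter\<close>

lemma diameter_mono_convex_body:
  assumes "convex_body C" "is_division C n P" "K \<in> P"
  shows "diameter K \<le> diameter C"
  using assms is_division_facts[OF assms(2)] by (intro diameter_subset) (auto simp: convex_body_def compact_imp_bounded)

text \<open>In dimension three and higher, hyperplanes through \<open>p\<close>, \<open>q\<close> and an interior point cut
  off piece after piece without separating \<open>p\<close> from \<open>q\<close>.\<close>

lemma splits_through_segment:
  fixes K :: "'a::euclidean_space set"
  assumes dim: "3 \<le> DIM('a)" and "0 < n" "convex_body K" "p \<in> K" "q \<in> K"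
  shows "splits (\<lambda>L. convex_body L \<and> p \<in> L \<and> q \<in> L) n K"
  using assms(2-)
proof (induction n arbitrary: K rule: nat_induct_non_zero)
  case 1
  then show ?case
    using splits_1_iff by blast
next
  case (Suc n)
  obtain z where z: "z \<in> interior K"
    using Suc.prems(1) convex_bodyD(3) by blast
  have "dim {p - z, q - z} \<le> card {p - z, q - z}"
    by (rule dim_le_card') simp
  also have "\<dots> \<le> 2"
    by (simp add: card_insert_if)
  finally have "dim {p - z, q - z} < DIM('a)"
    using dim by simp
  then obtain a where a: "a \<noteq> 0" "\<And>y. y \<in> span {p - z, q - z} \<Longrightarrow> orthogonal a y"
    by (rule orthogonal_to_subspace_exists) blast
  have "a \<bullet> p = a \<bullet> z" "a \<bullet> q = a \<bullet> z"
    using a(2)[of "p - z"] a(2)[of "q - z"] by (auto simp: orthogonal_def inner_simps span_base)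
  moreover note cuts = convex_body_cut_interior[OF Suc.prems(1) z a(1)]
  ultimately have "splits (\<lambda>L. convex_body L \<and> p \<in> L \<and> q \<in> L) 1 (K \<inter> {x. a \<bullet> x \<le> a \<bullet> z})"
    "splits (\<lambda>L. convex_body L \<and> p \<in> L \<and> q \<in> L) n (K \<inter> {x. a \<bullet> x \<ge> a \<bullet> z})"
    using Suc.prems Suc.IH unfolding splits_1_iff by auto
  then show ?case
    using splits_node_general[OF a(1)] by fastforce
qed

text \<open>Here \<open>U\<close> and \<open>V\<close> stand for small neighbourhoods of the ends of a diameter. In the plane the
  line through these ends may miss the interior of \<open>K\<close>, but a hyperplane through interior points
  in \<open>U\<close> and in \<open>V\<close> always exists, and both halves meet \<open>U\<close> and \<open>V\<close> again.\<close>

lemma splits_near_segment: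
  fixes K :: "'a::euclidean_space set"
  assumes dim: "2 \<le> DIM('a)" and "0 < n" "convex_body K" "open U" "open V" "K \<inter> U \<noteq> {}" "K \<inter> V \<noteq> {}"
  shows "splits (\<lambda>L. convex_body L \<and> L \<inter> U \<noteq> {} \<and> L \<inter> V \<noteq> {}) n K"
  using assms(2-)
proof (induction n arbitrary: K rule: nat_induct_non_zero)
  case 1
  then show ?case
    using splits_1_iff by blast
next
  case (Suc n)
  have "K \<subseteq> closure (interior K)"
    using Suc.prems(1) closure_subset by (auto simp: convex_body_def convex_closure_interior)
  then have "U \<inter> interior K \<noteq> {}" "V \<inter> interior K \<noteq> {}"
    using Suc.prems open_Int_closure_eq_empty[of U "interior K"] open_Int_closure_eq_empty[of V "interior K"]
    by blast+
  then obtain p q where p: "p \<in> U" "p \<in> interior K" and q: "q \<in> V" "q \<in> interior K"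
    by blast
  obtain a where a: "a \<noteq> 0" "orthogonal (q - p) a"
    using orthogonal_to_vector_exists[OF dim] .
  then have "a \<bullet> q = a \<bullet> p"
    by (simp add: orthogonal_def inner_simps inner_commute)
  then have "K \<inter> {x. a \<bullet> x \<le> a \<bullet> p} \<inter> U \<noteq> {}" "K \<inter> {x. a \<bullet> x \<le> a \<bullet> p} \<inter> V \<noteq> {}"
    "K \<inter> {x. a \<bullet> x \<ge> a \<bullet> p} \<inter> U \<noteq> {}" "K \<inter> {x. a \<bullet> x \<ge> a \<bullet> p} \<inter> V \<noteq> {}"
    using p q interior_subset[of K] by force+
  then have "splits (\<lambda>L. convex_body L \<and> L \<inter> U \<noteq> {} \<and> L \<inter> V \<noteq> {}) 1 (K \<inter> {x. a \<bullet> x \<le> a \<bullet> p})"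
    "splits (\<lambda>L. convex_body L \<and> L \<inter> U \<noteq> {} \<and> L \<inter> V \<noteq> {}) n (K \<inter> {x. a \<bullet> x \<ge> a \<bullet> p})"
    using convex_body_cut_interior[OF Suc.prems(1) p(2) a(1)] Suc.prems Suc.IH
    unfolding splits_1_iff by auto
  then show ?case
    using splits_node_general[OF a(1)] by fastforce
qed

lemma min_value_diameter_le:
  assumes C: "convex_body C" and n: "0 < n" and P: "is_division C n P"
  shows "min_value diameter P \<le> diameter C"
proof -
  have "finite P" "P \<noteq> {}"
    using is_division_facts[OF P convex_bodyD(3)[OF C]] n by auto
  then obtain K where "K \<in> P" "min_value diameter P \<le> diameter K"
    unfolding min_value_def by (meson Min_le equals0I finite_imageI imageI)
  then show ?thesis
    using diameter_mono_convex_body[OF C P] by fastforce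
qed

theorem maxmin_value_diameter:
  fixes C :: "'a::euclidean_space set"
  assumes dim: "2 \<le> DIM('a)" and C: "convex_body C" and n: "0 < n"
  shows "maxmin_value diameter n C = diameter C"
proof -
  define V where "V = {min_value diameter P | P. is_division C n P}"
  obtain p q where pq: "p \<in> C" "q \<in> C" "dist p q = diameter C"
    using diameter_compact_attained convex_bodyD(1,4)[OF C] by blast
  have near: "\<exists>v\<in>V. diameter C - 2 * e \<le> v" if e: "0 < e" for e
  proof -
    have "splits (\<lambda>L. convex_body L \<and> L \<inter> ball p e \<noteq> {} \<and> L \<inter> ball q e \<noteq> {}) n C"
      using pq e by (intro splits_near_segment[OF dim n C]) auto
    then have "\<exists>P. is_division C n P \<and>
        (\<forall>L\<in>P. convex_body L \<and> L \<inter> ball p e \<noteq> {} \<and> L \<inter> ball q e \<noteq> {})"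
      by (rule splits_imp_is_division) (simp add: convex_bodyD)
    then obtain P where P: "is_division C n P"
      "\<forall>L\<in>P. convex_body L \<and> L \<inter> ball p e \<noteq> {} \<and> L \<inter> ball q e \<noteq> {}"
      by blast
    have "diameter C - 2 * e \<le> diameter L" if "L \<in> P" for L
    proof -
      have "L \<inter> ball p e \<noteq> {}" "L \<inter> ball q e \<noteq> {}"
        using P(2) that by blast+
      then obtain x y where xy: "x \<in> L" "dist p x < e" "y \<in> L" "dist q y < e"
        by auto
      have "dist x y \<le> diameter L"
        using P(2) that xy by (intro diameter_bounded_bound compact_imp_bounded convex_bodyD(1)) auto
      moreover have "dist p q \<le> dist p x + dist x y + dist y q"
        using dist_triangle[of p q x] dist_triangle[of x q y] by simp
      ultimately show ?thesis
        using pq(3) xy by (simp add: dist_commute)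
    qed
    moreover have "finite P" "P \<noteq> {}"
      using is_division_facts[OF P(1) convex_bodyD(3)[OF C]] n by auto
    ultimately have "diameter C - 2 * e \<le> min_value diameter P"
      by (simp add: min_value_def)
    then show ?thesis
      using P(1) by (auto simp: V_def)
  qed
  have le: "v \<le> diameter C" if "v \<in> V" for v
    using that min_value_diameter_le[OF C n] by (auto simp: V_def)
  have "V \<noteq> {}"
    using near[of 1] by auto
  have "Sup V = diameter C"
  proof (rule antisym)
    show "Sup V \<le> diameter C"
      using \<open>V \<noteq> {}\<close> le by (rule cSup_least)
    show "diameter C \<le> Sup V"
    proof (rule field_le_epsilon)
      fix e :: real
      assume "0 < e"
      then obtain v where "v \<in> V" "diameter C - e \<le> v"
        using near[of "e / 2"] by auto
      moreover have "bdd_above V"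
        using le by (rule bdd_aboveI)
      ultimately show "diameter C \<le> Sup V + e"
        using cSup_upper[of v V] by simp
    qed
  qed
  then show ?thesis
    by (simp add: maxmin_value_def V_def)
qed

lemma optimal_division_diameter_balanced:
  fixes C :: "'a::euclidean_space set"
  assumes dim: "2 \<le> DIM('a)" and C: "convex_body C" and n: "0 < n"
    and P: "optimal_division diameter n C P"
  shows "balanced diameter P"
proof -
  have div: "is_division C n P" and min: "min_value diameter P = diameter C"
    using P maxmin_value_diameter[OF dim C n] by (auto simp: optimal_division_def)
  have "finite P"
    using is_division_facts[OF div convex_bodyD(3)[OF C]] by simp
  then have "diameter C \<le> diameter K" if "K \<in> P" for K
    using that by (simp add: min[symmetric] min_value_def)
  then have "diameter K = diameter C" if "K \<in> P" for K
    using that diameter_mono_convex_body[OF C div] by (simp add: antisym)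
  then show ?thesis
    by (simp add: balanced_def)
qed

lemma ex_balanced_optimal_division_diameter:
  fixes C :: "'a::euclidean_space set"
  assumes dim: "3 \<le> DIM('a)" and C: "convex_body C" and n: "0 < n"
  shows "\<exists>P. optimal_division diameter n C P \<and> balanced diameter P"
proof -
  obtain p q where pq: "p \<in> C" "q \<in> C" "dist p q = diameter C"
    using diameter_compact_attained convex_bodyD(1,4)[OF C] by blast
  obtain P where P: "is_division C n P" "\<forall>L\<in>P. convex_body L \<and> p \<in> L \<and> q \<in> L"
    using splits_imp_is_division[OF splits_through_segment[OF dim n C pq(1,2)]] convex_bodyD(3)
    by blast
  have "diameter C \<le> diameter L" if "L \<in> P" for L
    unfolding pq(3)[symmetric] using P(2) that
    by (intro diameter_bounded_bound compact_imp_bounded convex_bodyD(1)) auto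
  moreover have "finite P" "P \<noteq> {}"
    using is_division_facts[OF P(1) convex_bodyD(3)[OF C]] n by auto
  ultimately have "diameter C \<le> min_value diameter P"
    by (simp add: min_value_def)
  then have "min_value diameter P = maxmin_value diameter n C"
    using min_value_diameter_le[OF C n P(1)] maxmin_value_diameter[OF _ C n] dim by simp
  then have "optimal_division diameter n C P"
    using P(1) by (simp add: optimal_division_def)
  then show ?thesis
    using optimal_division_diameter_balanced[OF _ C n] dim by auto
qed

section \<open>Sharpness of the bounds for the width\<close>

text \<open>For a ball the width equals the diameter, so for two pieces the bounds \<open>w / 2\<close> and
  \<open>D / 2\<close> coincide.\<close>

lemma width_lower_bound_sharp:
  "min_width (cball 0 1 :: 'a::euclidean_space set) / real 2 =
    maxmin_value min_width 2 (cball 0 1 :: 'a set)"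
proof -
  let ?B = "cball 0 1 :: 'a set"
  have B: "convex_body ?B"
    by (auto simp: convex_body_def)
  have "2 \<le> min_width ?B"
    using min_width_ge_cball[of 0 1 ?B] by simp
  moreover have "maxmin_value min_width 2 ?B \<le> 1"
    using width.maxmin_value_le_half_diameter[OF B, of 2] by simp
  moreover have "min_width ?B / real 2 \<le> maxmin_value min_width 2 ?B"
    using width.maxmin_value_ge_div[OF B, of 2] by simp
  ultimately show ?thesis
    by simp
qed

text \<open>A slab of width two, truncated by a ball large enough to leave two unit balls side by
  side in it, has width two, and so have both pieces if the cut separates the two balls.\<close>

lemma width_upper_bound_sharp:
  assumes dim: "2 \<le> DIM('a::euclidean_space)"
  shows "\<exists>B :: 'a set. convex_body B \<and>
    maxmin_value min_width 2 B = min (min_width B) (diameter B / 2)"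
proof -
  obtain u :: 'a where u: "norm u = 1"
    using vector_choose_size[of 1] by auto
  obtain v' where v': "v' \<noteq> 0" "orthogonal u v'"
    using orthogonal_to_vector_exists[OF dim] .
  define v where "v = v' /\<^sub>R norm v'"
  have v: "norm v = 1" "u \<bullet> v = 0"
    using v' by (auto simp: v_def orthogonal_def)
  have vv: "v \<bullet> v = 1"
    using v by (simp add: dot_square_norm)
  define B where "B = cball 0 2 \<inter> {x. u \<bullet> x \<le> 1} \<inter> {x. u \<bullet> x \<ge> - 1}"
  have inner_le: "\<bar>w \<bullet> y\<bar> \<le> 1" if "norm w = 1" "norm y \<le> 1" for w y :: 'a
    using Cauchy_Schwarz_ineq2[of w y] that by simp
  have balls: "cball v 1 \<subseteq> B \<inter> {x. v \<bullet> x \<ge> 0}" "cball (- v) 1 \<subseteq> B \<inter> {x. v \<bullet> x \<le> 0}"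
  proof -
    have in_B: "s *\<^sub>R v + y \<in> B" if s: "\<bar>s\<bar> = 1" and y: "norm y \<le> 1" for s y
    proof -
      have "norm (s *\<^sub>R v + y) \<le> 2"
        using norm_triangle_ineq[of "s *\<^sub>R v" y] v s y by simp
      moreover have "u \<bullet> (s *\<^sub>R v + y) = u \<bullet> y"
        using v by (simp add: inner_simps)
      ultimately show ?thesis
        using inner_le[OF u y] by (auto simp: B_def abs_le_iff)
    qed
    show "cball v 1 \<subseteq> B \<inter> {x. v \<bullet> x \<ge> 0}"
    proof
      fix x
      assume "x \<in> cball v 1"
      then have y: "norm (x - v) \<le> 1"
        by (simp add: dist_norm norm_minus_commute)
      then show "x \<in> B \<inter> {x. v \<bullet> x \<ge> 0}"
        using in_B[of 1 "x - v"] inner_le[OF v(1) y] by (simp add: inner_simps vv)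
    qed
    show "cball (- v) 1 \<subseteq> B \<inter> {x. v \<bullet> x \<le> 0}"
    proof
      fix x
      assume "x \<in> cball (- v) 1"
      then have y: "norm (x + v) \<le> 1"
        using norm_minus_commute[of "- v" x] by (simp add: dist_norm)
      then show "x \<in> B \<inter> {x. v \<bullet> x \<le> 0}"
        using in_B[of "- 1" "x + v"] inner_le[OF v(1) y] by (simp add: inner_simps vv)
    qed
  qed
  have B: "compact B" "convex B"
    unfolding B_def by (auto intro!: compact_cut compact_cut' convex_cut convex_cut')
  have body: "convex_body L" if "cball x 1 \<subseteq> L" "compact L" "convex L" for x :: 'a and L
    using _ that by (rule convex_body_superset) (simp add: convex_body_def)
  have "cball v 1 \<subseteq> B"
    using balls(1) by (rule order_trans) (rule Int_lower1)
  then have cb: "convex_body B"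
    using B by (rule body)
  have fit: "width.fits 2 1 L" if "cball x 1 \<subseteq> L" "compact L" "convex L" for x :: 'a and L
    using body[OF that] min_width_ge_cball[OF that(1) _ that(2)] unfolding width.fits_1_iff by simp
  have fits: "width.fits 2 1 (B \<inter> {x. v \<bullet> x \<le> 0})" "width.fits 2 1 (B \<inter> {x. v \<bullet> x \<ge> 0})"
    by (rule fit[OF balls(2) compact_cut[OF B(1)] convex_cut[OF B(2)]],
        rule fit[OF balls(1) compact_cut'[OF B(1)] convex_cut'[OF B(2)]])
  have "2 \<le> maxmin_value min_width 2 B"
    using width.fits_nodeI[OF v(1) fits] width.le_maxmin_value_iff[OF cb, of 2 2]
    by (simp add: numeral_2_eq_2)
  moreover have "min_width B \<le> 1 - (- 1)"
    using B(1) convex_bodyD(4)[OF cb] u by (rule min_width_le_slab) (auto simp: B_def)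
  moreover have "maxmin_value min_width 2 B \<le> min (min_width B) (diameter B / 2)"
    using width.maxmin_value_le[OF cb, of 2] width.maxmin_value_le_half_diameter[OF cb, of 2] by simp
  ultimately have "maxmin_value min_width 2 B = min (min_width B) (diameter B / 2)"
    by linarith
  then show ?thesis
    using cb by blast
qed

section \<open>Max-min divisions for the diameter, the width and the inradius\<close>

theorem theoremB:
  fixes C :: "'a::euclidean_space set" and n :: nat
  assumes "DIM('a) \<ge> 2" and "convex_body C" and "n \<ge> 2"
  shows "(\<forall>F\<in>{diameter, min_width, inradius}. \<not> (DIM('a) = 2 \<and> F = diameter) \<longrightarrow>
            (\<exists>P. optimal_division F n C P \<and> balanced F P)) \<and>
         ((\<forall>P. optimal_division diameter n C P \<longrightarrow> balanced diameter P) \<and>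
           maxmin_value diameter n C = diameter C) \<and>
         (min_width C / real n \<le> maxmin_value min_width n C \<and>
           maxmin_value min_width n C \<le> min (min_width C) (diameter C / 2) \<and>
           (\<exists>(B::'a set) m. convex_body B \<and> m \<ge> 2 \<and>
              min_width B / real m = maxmin_value min_width m B) \<and>
           (\<exists>(B::'a set) m. convex_body B \<and> m \<ge> 2 \<and>
              maxmin_value min_width m B = min (min_width B) (diameter B / 2))) \<and>
         inradius C / real n \<le> maxmin_value inradius n C"
proof (intro conjI)
  have n: "0 < n"
    using assms(3) by simp
  note C = assms(2)
  show "\<forall>F\<in>{diameter, min_width, inradius}. \<not> (DIM('a) = 2 \<and> F = diameter) \<longrightarrow>
      (\<exists>P. optimal_division F n C P \<and> balanced F P)"
  proof (intro ballI impI)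
    fix F :: "'a set \<Rightarrow> real"
    assume F: "F \<in> {diameter, min_width, inradius}" and ex: "\<not> (DIM('a) = 2 \<and> F = diameter)"
    from F consider "F = diameter" | "F = min_width" | "F = inradius"
      by blast
    then show "\<exists>P. optimal_division F n C P \<and> balanced F P"
    proof cases
      case 1
      then have "3 \<le> DIM('a)"
        using ex assms(1) by linarith
      then show ?thesis
        unfolding 1 using C n by (rule ex_balanced_optimal_division_diameter)
    next
      case 2
      show ?thesis
        unfolding 2 using C n by (rule width.ex_balanced_optimal_division)
    next
      case 3
      show ?thesis
        unfolding 3 using C n by (rule inradius.ex_balanced_optimal_division)
    qed
  qed
  show "\<forall>P. optimal_division diameter n C P \<longrightarrow> balanced diameter P"
    using optimal_division_diameter_balanced[OF assms(1) C n] by blast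
  show "maxmin_value diameter n C = diameter C"
    using assms(1) C n by (rule maxmin_value_diameter)
  show "min_width C / real n \<le> maxmin_value min_width n C"
    using C n by (rule width.maxmin_value_ge_div)
  show "maxmin_value min_width n C \<le> min (min_width C) (diameter C / 2)"
    using width.maxmin_value_le[OF C n] width.maxmin_value_le_half_diameter[OF C assms(3)] by simp
  have "convex_body (cball 0 1 :: 'a set)"
    by (auto simp: convex_body_def)
  then show "\<exists>(B::'a set) m. convex_body B \<and> m \<ge> 2 \<and>
      min_width B / real m = maxmin_value min_width m B"
    using width_lower_bound_sharp[where 'a = 'a] by blast
  show "\<exists>(B::'a set) m. convex_body B \<and> m \<ge> 2 \<and>
      maxmin_value min_width m B = min (min_width B) (diameter B / 2)"
    using width_upper_bound_sharp[OF assms(1)] by blast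
  show "inradius C / real n \<le> maxmin_value inradius n C"
    using C n by (rule inradius.maxmin_value_ge_div)
qed

end
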